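(* Let $K$ be a field of characteristic $0$, $d\ge2$, and let $\alpha=(\alpha_1,\alpha_2)\in K^2$, $\alpha\ne(0,0)$, with $\alpha_1=\alpha_2$. In $G_d(\mathfrak U_\alpha)$ the consequences of degree $n+1$ of polynomials of degree $n$ are as follows: (i) Any identity of degree $n=1,2,3$ implies all polynomials of degree $n+1$. (ii) $w_{(3,1)}^{(2)}$ has no (nonzero) consequences of higher degree.
   Context: A bicommutative algebra is a nonassociative $K$-algebra satisfying $(x_1x_2)x_3=(x_1x_3)x_2$ and $x_1(x_2x_3)=x_2(x_1x_3)$; $\mathfrak B$ is the variety of all of them. The free bicommutative algebra $F_d(\mathfrak B)$ on $x_1,\dots,x_d$ is identified (via $x_i\mapsto x_i$) with the algebra $G_d$ having as basis $x_1,\dots,x_d$ together with all monomials $Y^aZ^b=y_1^{a_1}\cdots y_d^{a_d}z_1^{b_1}\cdots z_d^{b_d}$ in the polynomial algebra $K[y_1,\dots,y_d,z_1,\dots,z_d]$ with $|a|\ge1$ and $|b|\ge1$, and multiplication $x_ix_j=y_iz_j$, $x_i(Y^aZ^b)=y_iY^aZ^b$, $(Y^aZ^b)x_i=Y^aZ^bz_i$, $(Y^aZ^b)(Y^cZ^e)=Y^{a+c}Z^{b+e}$. Put $w_{(3,1)}^{(2)}=y_1^2(y_1z_2-y_2z_1)$. $\mathfrak U_\alpha$ is the variety of bicommutative algebras defined by the identity $\alpha_1x(xx)+\alpha_2(xx)x=0$, and $G_d(\mathfrak U_\alpha)\cong F_d(\mathfrak U_\alpha)$ is the factor algebra of $G_d$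 modulo the T-ideal (ideal closed under all endomorphisms) generated by $\alpha_1y_1^2z_1+\alpha_2y_1z_1^2$; elements of $G_d$ denote also their images. For a homogeneous $f$ of degree $n$ in $G_d(\mathfrak U_\alpha)$, its consequences of degree $m>n$ are the elements of the degree $m$ homogeneous component of the T-ideal of $G_d(\mathfrak U_\alpha)$ generated by $f$ (one says $f$ implies these elements). An "identity of degree $n$" is a nonzero homogeneous element of degree $n$ of $G_d(\mathfrak U_\alpha)$. *)

theory Defs
  imports Complex_Main "HOL-Library.Poly_Mapping"
begin

text \<open>Nonassociative (not necessarily unital) algebras over \<open>'k\<close>, with explicit carrier.\<close>

record ('k, 'a) nalg =
  na_carrier :: "'a set"
  na_zero :: "'a"
  na_add :: "'a \<Rightarrow> 'a \<Rightarrow> 'a"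
  na_smult :: "'k \<Rightarrow> 'a \<Rightarrow> 'a"
  na_mult :: "'a \<Rightarrow> 'a \<Rightarrow> 'a"

definition na_ideal :: "('k, 'a) nalg \<Rightarrow> 'a set \<Rightarrow> bool" where
  "na_ideal A I \<longleftrightarrow>
     I \<subseteq> na_carrier A \<and> na_zero A \<in> I \<and>
     (\<forall>u\<in>I. \<forall>v\<in>I. na_add A u v \<in> I) \<and>
     (\<forall>c. \<forall>u\<in>I. na_smult A c u \<in> I) \<and>
     (\<forall>u\<in>I. \<forall>f\<in>na_carrier A. na_mult A f u \<in> I \<and> na_mult A u f \<in> I)"

definition na_endo :: "('k, 'a) nalg \<Rightarrow> ('a \<Rightarrow> 'a) \<Rightarrow> bool" where
  "na_endo A \<phi> \<longleftrightarrow>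
     (\<forall>f\<in>na_carrier A. \<phi> f \<in> na_carrier A) \<and>
     (\<forall>f\<in>na_carrier A. \<forall>g\<in>na_carrier A. \<phi> (na_add A f g) = na_add A (\<phi> f) (\<phi> g)) \<and>
     (\<forall>c. \<forall>f\<in>na_carrier A. \<phi> (na_smult A c f) = na_smult A c (\<phi> f)) \<and>
     (\<forall>f\<in>na_carrier A. \<forall>g\<in>na_carrier A. \<phi> (na_mult A f g) = na_mult A (\<phi> f) (\<phi> g))"

definition T_ideal :: "('k, 'a) nalg \<Rightarrow> 'a set \<Rightarrow> bool" where
  "T_ideal A I \<longleftrightarrow> na_ideal A I \<and> (\<forall>\<phi>. na_endo A \<phi> \<longrightarrow> \<phi> ` I \<subseteq> I)"

definition T_ideal_generated :: "('k, 'a) nalg \<Rightarrow> 'a set \<Rightarrow> 'a set" where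
  "T_ideal_generated A S = \<Inter>{I. T_ideal A I \<and> S \<subseteq> I}"

definition na_coset :: "('k, 'a) nalg \<Rightarrow> 'a set \<Rightarrow> 'a \<Rightarrow> 'a set" where
  "na_coset A I f = (\<lambda>u. na_add A f u) ` I"

definition na_quot :: "('k, 'a) nalg \<Rightarrow> 'a set \<Rightarrow> ('k, 'a set) nalg" where
  "na_quot A I =
     \<lparr> na_carrier = na_coset A I ` na_carrier A,
       na_zero = na_coset A I (na_zero A),
       na_add = (\<lambda>X Y. \<Union>f\<in>X. \<Union>g\<in>Y. na_coset A I (na_add A f g)),
       na_smult = (\<lambda>c X. \<Union>f\<in>X. na_coset A I (na_smult A c f)),
       na_mult = (\<lambda>X Y. \<Union>f\<in>X. \<Union>g\<in>Y. na_coset A I (na_mult A f g)) \<rparr>"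

text \<open>
  \<open>Gen i\<close> is the generator \<open>x\<^sub>i\<close>, and \<open>Mon a b\<close> is the monomial \<open>Y\<^sup>a Z\<^sup>b\<close> with exponent
  vectors \<open>a\<close> and \<open>b\<close>. The indices of the variables are \<open>1, \<dots>, d\<close>.
\<close>

datatype gbasis = Gen nat | Mon "nat \<Rightarrow>\<^sub>0 nat" "nat \<Rightarrow>\<^sub>0 nat"

definition expo_size :: "(nat \<Rightarrow>\<^sub>0 nat) \<Rightarrow> nat" where
  "expo_size a = (\<Sum>i\<in>Poly_Mapping.keys a. Poly_Mapping.lookup a i)"

fun gdeg :: "gbasis \<Rightarrow> nat" where
  "gdeg (Gen i) = 1"
| "gdeg (Mon a b) = expo_size a + expo_size b"

definition G_basis :: "nat \<Rightarrow> gbasis set" where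
  "G_basis d = Gen ` {1..d} \<union>
     {Mon a b | a b. Poly_Mapping.keys a \<subseteq> {1..d} \<and> Poly_Mapping.keys b \<subseteq> {1..d} \<and>
                     expo_size a \<ge> 1 \<and> expo_size b \<ge> 1}"

fun gbasis_mult :: "gbasis \<Rightarrow> gbasis \<Rightarrow> gbasis" where
  "gbasis_mult (Gen i) (Gen j) = Mon (Poly_Mapping.single i 1) (Poly_Mapping.single j 1)"
| "gbasis_mult (Gen i) (Mon a b) = Mon (Poly_Mapping.single i 1 + a) b"
| "gbasis_mult (Mon a b) (Gen i) = Mon a (b + Poly_Mapping.single i 1)"
| "gbasis_mult (Mon a b) (Mon c e) = Mon (a + c) (b + e)"

text \<open>Bilinear extension of the multiplication of basis elements.\<close>

definition G_mult :: "(gbasis \<Rightarrow>\<^sub>0 'k) \<Rightarrow> (gbasis \<Rightarrow>\<^sub>0 'k) \<Rightarrow> (gbasis \<Rightarrow>\<^sub>0 'k::field)" where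
  "G_mult f g = (\<Sum>p\<in>Poly_Mapping.keys f. \<Sum>q\<in>Poly_Mapping.keys g.
     Poly_Mapping.single (gbasis_mult p q) (Poly_Mapping.lookup f p * Poly_Mapping.lookup g q))"

definition G_alg :: "nat \<Rightarrow> ('k::field, gbasis \<Rightarrow>\<^sub>0 'k) nalg" where
  "G_alg d =
     \<lparr> na_carrier = {f. Poly_Mapping.keys f \<subseteq> G_basis d},
       na_zero = 0,
       na_add = (+),
       na_smult = (\<lambda>c. Poly_Mapping.map ((*) c)),
       na_mult = G_mult \<rparr>"

definition G_comp :: "nat \<Rightarrow> nat \<Rightarrow> (gbasis \<Rightarrow>\<^sub>0 'k::field) set" where
  "G_comp d n = {f \<in> na_carrier (G_alg d). \<forall>p\<in>Poly_Mapping.keys f. gdeg p = n}"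

text \<open>\<open>\<alpha>\<^sub>1 y\<^sub>1\<^sup>2 z\<^sub>1 + \<alpha>\<^sub>2 y\<^sub>1 z\<^sub>1\<^sup>2\<close>, the image of \<open>\<alpha>\<^sub>1 x(xx) + \<alpha>\<^sub>2 (xx)x\<close> for \<open>x = x\<^sub>1\<close>.\<close>

definition U_poly :: "'k \<Rightarrow> 'k \<Rightarrow> (gbasis \<Rightarrow>\<^sub>0 'k::field)" where
  "U_poly \<alpha>1 \<alpha>2 =
     Poly_Mapping.single (Mon (Poly_Mapping.single 1 2) (Poly_Mapping.single 1 1)) \<alpha>1 +
     Poly_Mapping.single (Mon (Poly_Mapping.single 1 1) (Poly_Mapping.single 1 2)) \<alpha>2"

definition U_ideal :: "nat \<Rightarrow> 'k \<Rightarrow> 'k \<Rightarrow> (gbasis \<Rightarrow>\<^sub>0 'k::field) set" where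
  "U_ideal d \<alpha>1 \<alpha>2 = T_ideal_generated (G_alg d) {U_poly \<alpha>1 \<alpha>2}"

definition GU_alg :: "nat \<Rightarrow> 'k \<Rightarrow> 'k \<Rightarrow> ('k::field, (gbasis \<Rightarrow>\<^sub>0 'k) set) nalg" where
  "GU_alg d \<alpha>1 \<alpha>2 = na_quot (G_alg d) (U_ideal d \<alpha>1 \<alpha>2)"

definition GU_proj :: "nat \<Rightarrow> 'k \<Rightarrow> 'k \<Rightarrow> (gbasis \<Rightarrow>\<^sub>0 'k::field) \<Rightarrow> (gbasis \<Rightarrow>\<^sub>0 'k) set" where
  "GU_proj d \<alpha>1 \<alpha>2 = na_coset (G_alg d) (U_ideal d \<alpha>1 \<alpha>2)"

definition GU_comp :: "nat \<Rightarrow> 'k \<Rightarrow> 'k \<Rightarrow> nat \<Rightarrow> (gbasis \<Rightarrow>\<^sub>0 'k::field) set set" where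
  "GU_comp d \<alpha>1 \<alpha>2 n = GU_proj d \<alpha>1 \<alpha>2 ` G_comp d n"

definition consequences ::
  "nat \<Rightarrow> 'k \<Rightarrow> 'k \<Rightarrow> (gbasis \<Rightarrow>\<^sub>0 'k::field) set \<Rightarrow> nat \<Rightarrow> (gbasis \<Rightarrow>\<^sub>0 'k) set set" where
  "consequences d \<alpha>1 \<alpha>2 f m =
     T_ideal_generated (GU_alg d \<alpha>1 \<alpha>2) {f} \<inter> GU_comp d \<alpha>1 \<alpha>2 m"

text \<open>\<open>y\<^sub>1\<^sup>2 (y\<^sub>1 z\<^sub>2 - y\<^sub>2 z\<^sub>1)\<close>, expanded into monomials.\<close>

definition w31_2 :: "gbasis \<Rightarrow>\<^sub>0 'k::field" where
  "w31_2 =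
     Poly_Mapping.single (Mon (Poly_Mapping.single 1 3) (Poly_Mapping.single 2 1)) 1 -
     Poly_Mapping.single (Mon (Poly_Mapping.single 1 2 + Poly_Mapping.single 2 1)
                              (Poly_Mapping.single 1 1)) 1"

end

theory Submission
  imports Defs "HOL-Library.Product_Plus"
begin

text \<open>
  Sending \<open>x\<^sub>i\<close> to \<open>(y\<^sub>i, z\<^sub>i)\<close> and a monomial \<open>m\<close> to \<open>(m, m)\<close> embeds \<open>G\<^sub>d\<close> into pairs of polynomials with
  product \<open>(a, b)(c, e) = (ae, ae)\<close>, so every assignment \<open>x\<^sub>i \<mapsto> g\<^sub>i\<close> extends to an endomorphism, and
  inclusion-exclusion over substitutions polarises any element of a T-ideal.

  Polarising \<open>yz(y + z)\<close>, with generators and with elements of \<open>G\<^sub>d\<^sup>2\<close> substituted, gives in degree 4, for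
  \<open>v\<^sub>i = z\<^sub>i y\<^sub>j y\<^sub>k y\<^sub>l\<close>: \<open>v\<^sub>i + v\<^sub>j + v\<^sub>k + v\<^sub>l = 0\<close>, \<open>y\<^sub>i z\<^sub>j z\<^sub>k z\<^sub>l = - v\<^sub>i\<close> and
  \<open>2 y\<^sub>i y\<^sub>j z\<^sub>k z\<^sub>l = v\<^sub>i + v\<^sub>j\<close>. Multiplying the second relation by \<open>y\<^sub>m\<close> (or \<open>z\<^sub>m\<close>) shows that all
  degree 5 monomials of a given shape coincide, and the first one kills them; hence everything of degree at
  least 5 vanishes, which is (ii).

  For (i) in degree 3, the polarisation of \<open>f\<close> has six coefficients for each triple of indices. If they always
  agree, \<open>f\<close> is zero in the quotient. Otherwise multiplying by \<open>y\<^sub>l\<close> or \<open>z\<^sub>l\<close> gives a relation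
  \<open>c\<^sub>1 v\<^sub>p + c\<^sub>2 v\<^sub>q + c\<^sub>3 v\<^sub>r = 0\<close> with some nonzero coefficient; exchanging \<open>p\<close> and \<open>l\<close> yields \<open>v\<^sub>p = v\<^sub>l\<close>,
  so that all \<open>v\<close> vanish. Degrees 1 and 2 are similar and easier.
\<close>

subsection \<open>Linear extension\<close>

abbreviation scale :: "'k \<Rightarrow> ('a \<Rightarrow>\<^sub>0 'k) \<Rightarrow> ('a \<Rightarrow>\<^sub>0 'k::field)" where
  "scale c \<equiv> Poly_Mapping.map ((*) c)"

definition lin_ext :: "('a \<Rightarrow> 'b \<Rightarrow>\<^sub>0 'k) \<Rightarrow> ('a \<Rightarrow>\<^sub>0 'k) \<Rightarrow> ('b \<Rightarrow>\<^sub>0 'k::field)" where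
  "lin_ext h f = (\<Sum>p\<in>Poly_Mapping.keys f. scale (Poly_Mapping.lookup f p) (h p))"

lemma lookup_scale [simp]: "Poly_Mapping.lookup (scale c f) p = c * Poly_Mapping.lookup f p"
  by (simp add: Poly_Mapping.map.rep_eq when_def)

lemma scale_add: "scale c (f + g) = scale c f + scale c g"
  by (rule poly_mapping_eqI) (simp add: lookup_add algebra_simps)

lemma scale_add_left: "scale (b + c) f = scale b f + scale c f"
  by (rule poly_mapping_eqI) (simp add: lookup_add algebra_simps)

lemma scale_zero [simp]: "scale c 0 = 0" "scale 0 f = 0"
  by (rule poly_mapping_eqI, simp)+

lemma scale_one [simp]: "scale 1 f = f"
  by (rule poly_mapping_eqI) simp

lemma scale_scale [simp]: "scale b (scale c f) = scale (b * c) f"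
  by (rule poly_mapping_eqI) simp

lemma scale_single [simp]: "scale b (Poly_Mapping.single p c) = Poly_Mapping.single p (b * c)"
  by (rule poly_mapping_eqI) (simp add: lookup_single when_def)

lemma scale_sum: "scale c (\<Sum>i\<in>I. F i) = (\<Sum>i\<in>I. scale c (F i))"
  by (induction I rule: infinite_finite_induct) (auto simp: scale_add)

lemma keys_scale: "Poly_Mapping.keys (scale c f) \<subseteq> Poly_Mapping.keys f"
  by (auto simp: in_keys_iff)

lemma lin_ext_superset:
  assumes "finite S" "Poly_Mapping.keys f \<subseteq> S"
  shows "lin_ext h f = (\<Sum>p\<in>S. scale (Poly_Mapping.lookup f p) (h p))"
  unfolding lin_ext_def using assms
  by (intro sum.mono_neutral_left) (auto simp: in_keys_iff)

lemma lin_ext_add: "lin_ext h (f + g) = lin_ext h f + lin_ext h g"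
proof -
  let ?S = "Poly_Mapping.keys f \<union> Poly_Mapping.keys g"
  have "lin_ext h k = (\<Sum>p\<in>?S. scale (Poly_Mapping.lookup k p) (h p))"
    if "Poly_Mapping.keys k \<subseteq> ?S" for k
    using that by (intro lin_ext_superset) auto
  from this[of f] this[of g] this[of "f + g"] show ?thesis
    using keys_add[of f g] by (simp add: lookup_add scale_add_left sum.distrib)
qed

lemma lin_ext_scale: "lin_ext h (scale c f) = scale c (lin_ext h f)"
proof -
  have "lin_ext h (scale c f) =
      (\<Sum>p\<in>Poly_Mapping.keys f. scale (Poly_Mapping.lookup (scale c f) p) (h p))"
    by (rule lin_ext_superset) (auto simp: keys_scale)
  then show ?thesis by (simp add: lin_ext_def scale_sum)
qed

lemma lin_ext_zero [simp]: "lin_ext h 0 = 0"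
  by (simp add: lin_ext_def)

lemma lin_ext_single [simp]: "lin_ext h (Poly_Mapping.single p c) = scale c (h p)"
  by (simp add: lin_ext_def)

lemma lin_ext_sum: "lin_ext h (\<Sum>i\<in>I. F i) = (\<Sum>i\<in>I. lin_ext h (F i))"
  by (induction I rule: infinite_finite_induct) (auto simp: lin_ext_add)

lemma lin_ext_diff: "lin_ext h (f - g) = lin_ext h f - lin_ext h g"
  using lin_ext_add[of h "f - g" g] by simp

lemma poly_mapping_expansion:
  "(\<Sum>p\<in>Poly_Mapping.keys f. Poly_Mapping.single p (Poly_Mapping.lookup f p)) = f"
  by (rule poly_mapping_eqI)
    (auto simp: lookup_sum lookup_single when_def in_keys_iff)

lemma poly_mapping_linear_induct [case_names zero add single]:
  fixes f :: "'a \<Rightarrow>\<^sub>0 'b::comm_monoid_add"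
  assumes "P 0" "\<And>f g. P f \<Longrightarrow> P g \<Longrightarrow> P (f + g)" "\<And>p c. P (Poly_Mapping.single p c)"
  shows "P f"
proof -
  have "P (\<Sum>p\<in>A. Poly_Mapping.single p (Poly_Mapping.lookup f p))" if "finite A" for A
    using that by (induction A) (auto intro: assms)
  then show ?thesis by (metis poly_mapping_expansion finite_keys)
qed

text \<open>Both sides are bilinear in \<open>f\<close> and \<open>g\<close>, so only products of
  two single terms have to be compared. This makes polynomial substitution multiplicative.\<close>

lemma lin_ext_mult:
  fixes h :: "'a::comm_monoid_add \<Rightarrow> 'b::comm_monoid_add \<Rightarrow>\<^sub>0 'k::field"
  assumes "\<And>p q. h (p + q) = h p * h q"
  shows "lin_ext h (f * g) = lin_ext h f * lin_ext h g"
proof (induction f rule: poly_mapping_linear_induct)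
  case (single p c)
  show ?case
  proof (induction g rule: poly_mapping_linear_induct)
    case (single q e)
    have "Poly_Mapping.single 0 (c * e) = Poly_Mapping.single (0::'b) c * Poly_Mapping.single 0 e"
      by (simp add: mult_single)
    then show ?case
      by (simp add: mult_single assms mult_map_scale_conv_mult mult_ac)
  qed (simp_all add: lin_ext_add algebra_simps)
qed (simp_all add: lin_ext_add algebra_simps)

subsection \<open>The embedding of \<open>G\<^sub>d\<close> into pairs of polynomials\<close>

text \<open>Exponent pairs add componentwise, so the convolution product is that of the commutative
  polynomial ring in the \<open>y_i\<close> and \<open>z_i\<close>; the indices are not bounded by
  \<open>d\<close> here.\<close>

type_synonym 'k yzpoly = "((nat \<Rightarrow>\<^sub>0 nat) \<times> (nat \<Rightarrow>\<^sub>0 nat)) \<Rightarrow>\<^sub>0 'k"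

fun left_mon :: "gbasis \<Rightarrow> (nat \<Rightarrow>\<^sub>0 nat) \<times> (nat \<Rightarrow>\<^sub>0 nat)" where
  "left_mon (Gen i) = (Poly_Mapping.single i 1, 0)"
| "left_mon (Mon a b) = (a, b)"

fun right_mon :: "gbasis \<Rightarrow> (nat \<Rightarrow>\<^sub>0 nat) \<times> (nat \<Rightarrow>\<^sub>0 nat)" where
  "right_mon (Gen i) = (0, Poly_Mapping.single i 1)"
| "right_mon (Mon a b) = (a, b)"

definition left_poly :: "(gbasis \<Rightarrow>\<^sub>0 'k) \<Rightarrow> 'k::field yzpoly" where
  "left_poly = lin_ext (\<lambda>p. Poly_Mapping.single (left_mon p) 1)"

definition right_poly :: "(gbasis \<Rightarrow>\<^sub>0 'k) \<Rightarrow> 'k::field yzpoly" where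
  "right_poly = lin_ext (\<lambda>p. Poly_Mapping.single (right_mon p) 1)"

text \<open>Inverse of the diagonal part of the embedding, which sends a monomial \<open>m\<close>
  to \<open>(m, m)\<close>. It is total: a monomial without a \<open>y\<close> or without a
  \<open>z\<close> goes outside \<open>G_basis d\<close>.\<close>

definition of_yz :: "'k yzpoly \<Rightarrow> (gbasis \<Rightarrow>\<^sub>0 'k::field)" where
  "of_yz = lin_ext (\<lambda>(a, b). Poly_Mapping.single (Mon a b) 1)"

definition yvar :: "nat \<Rightarrow> 'k::field yzpoly" where
  "yvar i = Poly_Mapping.single (Poly_Mapping.single i 1, 0) 1"

definition zvar :: "nat \<Rightarrow> 'k::field yzpoly" where
  "zvar i = Poly_Mapping.single (0, Poly_Mapping.single i 1) 1"

definition gen :: "nat \<Rightarrow> (gbasis \<Rightarrow>\<^sub>0 'k::field)" where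
  "gen i = Poly_Mapping.single (Gen i) 1"

lemma left_poly_simps [simp]:
  "left_poly (f + g) = left_poly f + left_poly g" "left_poly 0 = 0"
  "left_poly (gen i) = yvar i"
  by (simp_all add: left_poly_def lin_ext_add gen_def yvar_def)

lemma right_poly_simps [simp]:
  "right_poly (f + g) = right_poly f + right_poly g" "right_poly 0 = 0"
  "right_poly (gen i) = zvar i"
  by (simp_all add: right_poly_def lin_ext_add gen_def zvar_def)

lemma of_yz_simps [simp]:
  "of_yz (x + y) = of_yz x + of_yz y" "of_yz 0 = 0"
  "of_yz (x - y) = of_yz x - of_yz y"
  "of_yz (\<Sum>i\<in>I. F i) = (\<Sum>i\<in>I. of_yz (F i))"
  by (simp_all add: of_yz_def lin_ext_add lin_ext_diff lin_ext_sum)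

lemma of_yz_const_mult: "of_yz (Poly_Mapping.single 0 c * x) = scale c (of_yz x)"
  unfolding of_yz_def mult_map_scale_conv_mult[symmetric] by (rule lin_ext_scale)

lemma of_yz_single [simp]:
  "of_yz (Poly_Mapping.single (a, b) c) = Poly_Mapping.single (Mon a b) c"
  by (simp add: of_yz_def)

lemma left_right_poly_of_yz [simp]: "left_poly (of_yz x) = x" "right_poly (of_yz x) = x"
proof -
  have "left_poly (of_yz x) = x \<and> right_poly (of_yz x) = x"
  proof (induction x rule: poly_mapping_linear_induct)
    case (single p c)
    then show ?case by (cases p) (simp add: left_poly_def right_poly_def)
  qed simp_all
  then show "left_poly (of_yz x) = x" "right_poly (of_yz x) = x" by simp_all
qed

text \<open>Only the left coordinate of the first factor and the right coordinate of the second
  survive, which merges the four clauses of the multiplication into one formula.\<close>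

lemma gbasis_mult_eq:
  "Poly_Mapping.single (gbasis_mult p q) c = of_yz (Poly_Mapping.single (left_mon p + right_mon q) c)"
  by (cases p; cases q) simp_all

text \<open>Products in the algebra become products of commutative polynomials. In particular, on
  the image of \<open>of_yz\<close>, left multiplication by \<open>gen i\<close> is multiplication
  by \<open>yvar i\<close>, and right multiplication is multiplication by
  \<open>zvar i\<close>.\<close>

lemma G_mult_eq: "G_mult f g = of_yz (left_poly f * right_poly g)"
  unfolding G_mult_def left_poly_def right_poly_def lin_ext_def
  by (simp add: gbasis_mult_eq sum_product mult_single)

subsection \<open>Substitutions\<close>

definition expo_eval :: "(nat \<Rightarrow> 'a) \<Rightarrow> (nat \<Rightarrow>\<^sub>0 nat) \<Rightarrow> 'a::comm_monoid_mult" where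
  "expo_eval s a = (\<Prod>i\<in>Poly_Mapping.keys a. s i ^ Poly_Mapping.lookup a i)"

lemma expo_eval_superset:
  assumes "finite S" "Poly_Mapping.keys a \<subseteq> S"
  shows "expo_eval s a = (\<Prod>i\<in>S. s i ^ Poly_Mapping.lookup a i)"
  unfolding expo_eval_def using assms
  by (intro prod.mono_neutral_left) (auto simp: in_keys_iff)

lemma expo_eval_add: "expo_eval s (a + b) = expo_eval s a * expo_eval s b"
proof -
  let ?S = "Poly_Mapping.keys a \<union> Poly_Mapping.keys b"
  have "expo_eval s k = (\<Prod>i\<in>?S. s i ^ Poly_Mapping.lookup k i)"
    if "Poly_Mapping.keys k \<subseteq> ?S" for k
    using that by (intro expo_eval_superset) auto
  from this[of a] this[of b] this[of "a + b"] show ?thesis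
    using keys_add[of a b] by (simp add: lookup_add power_add prod.distrib)
qed

lemma expo_eval_simps [simp]: "expo_eval s 0 = 1" "expo_eval s (Poly_Mapping.single i n) = s i ^ n"
  by (simp_all add: expo_eval_def)

text \<open>The ring endomorphism of the polynomial ring induced by an assignment of the generators:
  \<open>y_i\<close> goes to the left coordinate of \<open>\<sigma> i\<close>, \<open>z_i\<close> to
  the right one.\<close>

definition yz_subst :: "(nat \<Rightarrow> gbasis \<Rightarrow>\<^sub>0 'k) \<Rightarrow> 'k yzpoly \<Rightarrow> 'k::field yzpoly" where
  "yz_subst \<sigma> = lin_ext (\<lambda>(a, b).
     expo_eval (\<lambda>i. left_poly (\<sigma> i)) a * expo_eval (\<lambda>i. right_poly (\<sigma> i)) b)"

text \<open>A generator has to go to \<open>\<sigma> i\<close> itself: the two coordinates of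
  \<open>\<sigma> i\<close> differ in general, so it is not of the form
  \<open>of_yz x\<close>.\<close>

fun subst_basis :: "(nat \<Rightarrow> gbasis \<Rightarrow>\<^sub>0 'k) \<Rightarrow> gbasis \<Rightarrow> (gbasis \<Rightarrow>\<^sub>0 'k::field)" where
  "subst_basis \<sigma> (Gen i) = \<sigma> i"
| "subst_basis \<sigma> (Mon a b) = of_yz
     (expo_eval (\<lambda>i. left_poly (\<sigma> i)) a * expo_eval (\<lambda>i. right_poly (\<sigma> i)) b)"

definition G_subst :: "(nat \<Rightarrow> gbasis \<Rightarrow>\<^sub>0 'k) \<Rightarrow> (gbasis \<Rightarrow>\<^sub>0 'k) \<Rightarrow> (gbasis \<Rightarrow>\<^sub>0 'k::field)" where
  "G_subst \<sigma> = lin_ext (subst_basis \<sigma>)"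

lemma yz_subst_mult: "yz_subst \<sigma> (x * y) = yz_subst \<sigma> x * yz_subst \<sigma> y"
  unfolding yz_subst_def
  by (rule lin_ext_mult) (auto simp: expo_eval_add algebra_simps)

lemma yz_subst_simps [simp]:
  "yz_subst \<sigma> (x + y) = yz_subst \<sigma> x + yz_subst \<sigma> y"
  "yz_subst \<sigma> (\<Sum>i\<in>I. F i) = (\<Sum>i\<in>I. yz_subst \<sigma> (F i))"
  "yz_subst \<sigma> (yvar i) = left_poly (\<sigma> i)" "yz_subst \<sigma> (zvar i) = right_poly (\<sigma> i)"
  "yz_subst \<sigma> (Poly_Mapping.single 0 c) = Poly_Mapping.single 0 c"
  by (simp_all add: yz_subst_def yvar_def zvar_def lin_ext_add lin_ext_sum zero_prod_def)
    (metis mult.right_neutral scale_single single_one zero_prod_def)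

lemma G_subst_of_yz: "G_subst \<sigma> (of_yz x) = of_yz (yz_subst \<sigma> x)"
proof (induction x rule: poly_mapping_linear_induct)
  case (single p c)
  show ?case
    by (cases p) (simp add: G_subst_def yz_subst_def of_yz_def lin_ext_scale)
qed (simp_all add: G_subst_def yz_subst_def lin_ext_add)

text \<open>The embedding intertwines \<open>G_subst\<close> with \<open>yz_subst\<close>; this
  reduces multiplicativity of \<open>G_subst\<close> to that of a polynomial substitution.\<close>

lemma left_right_poly_G_subst:
  "left_poly (G_subst \<sigma> f) = yz_subst \<sigma> (left_poly f)"
  "right_poly (G_subst \<sigma> f) = yz_subst \<sigma> (right_poly f)"
proof -
  have "left_poly (G_subst \<sigma> f) = yz_subst \<sigma> (left_poly f) \<and>
        right_poly (G_subst \<sigma> f) = yz_subst \<sigma> (right_poly f)"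
  proof (induction f rule: poly_mapping_linear_induct)
    case (single p c)
    have "left_poly (scale c g) = scale c (left_poly g)"
         "right_poly (scale c g) = scale c (right_poly g)" for g
      by (simp_all add: left_poly_def right_poly_def lin_ext_scale)
    then show ?case
      by (cases p) (simp_all add: G_subst_def, simp_all add: left_poly_def right_poly_def yz_subst_def)
  qed (simp_all add: G_subst_def yz_subst_def lin_ext_add)
  then show "left_poly (G_subst \<sigma> f) = yz_subst \<sigma> (left_poly f)"
    "right_poly (G_subst \<sigma> f) = yz_subst \<sigma> (right_poly f)" by simp_all
qed

lemma G_subst_mult: "G_subst \<sigma> (G_mult f g) = G_mult (G_subst \<sigma> f) (G_subst \<sigma> g)"
  by (simp add: G_mult_eq G_subst_of_yz yz_subst_mult left_right_poly_G_subst)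

section \<open>Degrees in the y and z variables, and closure of the carrier\<close>

lemma expo_size_superset:
  assumes "finite S" "Poly_Mapping.keys a \<subseteq> S"
  shows "expo_size a = (\<Sum>i\<in>S. Poly_Mapping.lookup a i)"
  unfolding expo_size_def using assms
  by (intro sum.mono_neutral_left) (auto simp: in_keys_iff)

lemma expo_size_add: "expo_size (a + b) = expo_size a + expo_size b"
proof -
  let ?S = "Poly_Mapping.keys a \<union> Poly_Mapping.keys b"
  have "expo_size k = (\<Sum>i\<in>?S. Poly_Mapping.lookup k i)" if "Poly_Mapping.keys k \<subseteq> ?S" for k
    using that by (intro expo_size_superset) auto
  from this[of a] this[of b] this[of "a + b"] show ?thesis
    using keys_add[of a b] by (simp add: lookup_add sum.distrib)
qed

lemma expo_size_eq_0_iff: "expo_size a = 0 \<longleftrightarrow> a = 0"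
  by (auto simp: expo_size_def in_keys_iff) (metis in_keys_iff keys_eq_empty ex_in_conv)

lemma expo_size_single [simp]: "expo_size (Poly_Mapping.single i n) = n"
  by (simp add: expo_size_def)

text \<open>The bounds are lower bounds, so they add up under multiplication. Left coordinates of
  carrier elements lie in \<open>yz_part d 1 0\<close>, right coordinates in
  \<open>yz_part d 0 1\<close>, and \<open>of_yz\<close> maps \<open>yz_part d 1 1\<close> into the
  carrier.\<close>

definition yz_part :: "nat \<Rightarrow> nat \<Rightarrow> nat \<Rightarrow> 'k::field yzpoly set" where
  "yz_part d r s = {x. \<forall>(a, b) \<in> Poly_Mapping.keys x.
     Poly_Mapping.keys a \<subseteq> {1..d} \<and> Poly_Mapping.keys b \<subseteq> {1..d} \<and>
     r \<le> expo_size a \<and> s \<le> expo_size b}"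

lemma yz_part_mult:
  assumes "x \<in> yz_part d r s" "y \<in> yz_part d r' s'"
  shows "x * y \<in> yz_part d (r + r') (s + s')"
  unfolding yz_part_def
proof clarify
  fix a b assume "(a, b) \<in> Poly_Mapping.keys (x * y)"
  then obtain a1 b1 a2 b2 where "a = a1 + a2" "b = b1 + b2"
    "(a1, b1) \<in> Poly_Mapping.keys x" "(a2, b2) \<in> Poly_Mapping.keys y"
    using keys_mult[of x y] by fastforce
  with assms show "Poly_Mapping.keys a \<subseteq> {1..d} \<and> Poly_Mapping.keys b \<subseteq> {1..d} \<and>
     r + r' \<le> expo_size a \<and> s + s' \<le> expo_size b"
    using keys_add[of a1 a2] keys_add[of b1 b2]
    unfolding yz_part_def by (fastforce simp: expo_size_add)
qed

lemma yz_part_mono: "x \<in> yz_part d r s \<Longrightarrow> r' \<le> r \<Longrightarrow> s' \<le> s \<Longrightarrow> x \<in> yz_part d r' s'"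
  by (fastforce simp: yz_part_def)

lemma yz_part_one: "1 \<in> yz_part d 0 0"
  by (simp add: yz_part_def zero_prod_def)

lemma yz_part_power: "x \<in> yz_part d r s \<Longrightarrow> x ^ n \<in> yz_part d (n * r) (n * s)"
  by (induction n) (auto simp: yz_part_one intro: yz_part_mult)

lemma yz_part_expo_eval:
  assumes "\<And>i. s i \<in> yz_part d r t"
  shows "expo_eval s a \<in> yz_part d (expo_size a * r) (expo_size a * t)"
proof -
  have "(\<Prod>i\<in>S. s i ^ Poly_Mapping.lookup a i) \<in>
      yz_part d ((\<Sum>i\<in>S. Poly_Mapping.lookup a i) * r) ((\<Sum>i\<in>S. Poly_Mapping.lookup a i) * t)"
    if "finite S" for S
    using that
  proof (induction S)
    case (insert i S)
    then show ?case
      using yz_part_mult[OF yz_part_power[OF assms[of i], of "Poly_Mapping.lookup a i"] insert.IH]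
      by (simp only: prod.insert sum.insert distrib_right not_False_eq_True)
  qed (simp add: yz_part_one)
  then show ?thesis by (simp add: expo_eval_def expo_size_def)
qed

abbreviation G_carrier :: "nat \<Rightarrow> (gbasis \<Rightarrow>\<^sub>0 'k::field) set" where
  "G_carrier d \<equiv> {f. Poly_Mapping.keys f \<subseteq> G_basis d}"

lemma G_alg_simps [simp]:
  "na_carrier (G_alg d) = G_carrier d" "na_zero (G_alg d) = 0"
  "na_add (G_alg d) = (+)" "na_smult (G_alg d) = scale" "na_mult (G_alg d) = G_mult"
  by (simp_all add: G_alg_def)

lemma G_carrier_closed:
  "f \<in> G_carrier d \<Longrightarrow> g \<in> G_carrier d \<Longrightarrow> f + g \<in> G_carrier d"
  "f \<in> G_carrier d \<Longrightarrow> scale c f \<in> G_carrier d"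
  using keys_add[of f g] keys_scale[of c f] by auto

lemma keys_lin_extE:
  assumes "p \<in> Poly_Mapping.keys (lin_ext h f)"
  obtains q where "q \<in> Poly_Mapping.keys f" "p \<in> Poly_Mapping.keys (h q)"
proof -
  from subsetD[OF keys_sum assms[unfolded lin_ext_def]] obtain q where "q \<in> Poly_Mapping.keys f"
    "p \<in> Poly_Mapping.keys (scale (Poly_Mapping.lookup f q) (h q))"
    by blast
  then show ?thesis using that subsetD[OF keys_scale] by metis
qed

lemma left_right_poly_in_yz_part:
  assumes "g \<in> G_carrier d"
  shows "left_poly g \<in> yz_part d 1 0" "right_poly g \<in> yz_part d 0 1"
proof -
  have "Poly_Mapping.keys a \<subseteq> {1..d} \<and> Poly_Mapping.keys b \<subseteq> {1..d} \<and> 1 \<le> expo_size a"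
    if ab: "(a, b) \<in> Poly_Mapping.keys (left_poly g)" for a b
  proof -
    from keys_lin_extE[OF ab[unfolded left_poly_def]] obtain q where
      "q \<in> Poly_Mapping.keys g" and "(a, b) \<in> Poly_Mapping.keys (Poly_Mapping.single (left_mon q) (1::'a))"
      by blast
    then have "q \<in> G_basis d" "left_mon q = (a, b)" using assms by auto
    then show ?thesis by (cases q) (auto simp: G_basis_def)
  qed
  then show "left_poly g \<in> yz_part d 1 0" by (auto simp: yz_part_def)
  have "Poly_Mapping.keys a \<subseteq> {1..d} \<and> Poly_Mapping.keys b \<subseteq> {1..d} \<and> 1 \<le> expo_size b"
    if ab: "(a, b) \<in> Poly_Mapping.keys (right_poly g)" for a b
  proof -
    from keys_lin_extE[OF ab[unfolded right_poly_def]] obtain q where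
      "q \<in> Poly_Mapping.keys g" and "(a, b) \<in> Poly_Mapping.keys (Poly_Mapping.single (right_mon q) (1::'a))"
      by blast
    then have "q \<in> G_basis d" "right_mon q = (a, b)" using assms by auto
    then show ?thesis by (cases q) (auto simp: G_basis_def)
  qed
  then show "right_poly g \<in> yz_part d 0 1" by (auto simp: yz_part_def)
qed

lemma of_yz_in_G_carrier:
  assumes "x \<in> yz_part d 1 1"
  shows "of_yz x \<in> G_carrier d"
proof clarify
  fix p assume "p \<in> Poly_Mapping.keys (of_yz x)"
  from keys_lin_extE[OF this[unfolded of_yz_def]] obtain a b where
    "(a, b) \<in> Poly_Mapping.keys x" and "p \<in> Poly_Mapping.keys (Poly_Mapping.single (Mon a b) (1::'a))"
    by (metis (no_types, lifting) case_prod_conv surj_pair)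
  with assms show "p \<in> G_basis d"
    by (auto simp: G_basis_def yz_part_def)
qed

lemma G_mult_in_G_carrier:
  assumes "f \<in> G_carrier d" "g \<in> G_carrier d"
  shows "G_mult f g \<in> G_carrier d"
  unfolding G_mult_eq
  using yz_part_mult[OF left_right_poly_in_yz_part(1)[OF assms(1)] left_right_poly_in_yz_part(2)[OF assms(2)]]
  by (intro of_yz_in_G_carrier) (simp only: add_0 add_0_right)

text \<open>The image of \<open>Mon a b\<close> has at least \<open>expo_size a\<close> factors
  \<open>y\<close> and \<open>expo_size b\<close> factors \<open>z\<close> in each term, and both
  numbers are positive on \<open>G_basis d\<close>.\<close>

lemma G_subst_in_G_carrier:
  assumes "\<And>i. \<sigma> i \<in> G_carrier d" "f \<in> G_carrier d"
  shows "G_subst \<sigma> f \<in> G_carrier d"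
proof -
  have "subst_basis \<sigma> p \<in> G_carrier d" if "p \<in> G_basis d" for p
  proof (cases p)
    case (Mon a b)
    have "expo_eval (\<lambda>i. left_poly (\<sigma> i)) a \<in> yz_part d (expo_size a * 1) (expo_size a * 0)"
      "expo_eval (\<lambda>i. right_poly (\<sigma> i)) b \<in> yz_part d (expo_size b * 0) (expo_size b * 1)"
      using left_right_poly_in_yz_part assms(1) by (intro yz_part_expo_eval; blast)+
    moreover have "1 \<le> expo_size a" "1 \<le> expo_size b"
      using that Mon by (auto simp: G_basis_def)
    ultimately show ?thesis
      unfolding Mon subst_basis.simps
      by (intro of_yz_in_G_carrier yz_part_mono[OF yz_part_mult]) auto
  qed (use assms in auto)
  then show ?thesis
    using assms(2) unfolding G_subst_def by (blast elim: keys_lin_extE)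
qed

text \<open>Freeness in the form needed later: every assignment with values in the carrier yields an
  endomorphism, hence T-ideals are closed under such substitutions.\<close>

lemma na_endo_G_subst:
  assumes "\<And>i. \<sigma> i \<in> G_carrier d"
  shows "na_endo (G_alg d) (G_subst \<sigma>)"
  unfolding na_endo_def G_alg_simps
  using G_subst_in_G_carrier[OF assms] G_subst_mult
  by (auto simp: G_subst_def lin_ext_add lin_ext_scale)

subsection \<open>Monomials as products of variables\<close>

text \<open>Monomials as lists of variable indices. The order is irrelevant, but lists allow
  induction on the degree and case splits on the number of factors.\<close>

definition word :: "nat list \<Rightarrow> nat list \<Rightarrow> 'k::field yzpoly" where
  "word is js = prod_list (map yvar is) * prod_list (map zvar js)"

lemma word_simps [simp]:
  "word [] [] = 1" "word (i # is) js = yvar i * word is js" "word [] (j # js) = zvar j * word [] js"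
  by (simp_all add: word_def mult_ac)

lemma word_Cons_right: "word is (j # js) = zvar j * word is js"
  by (simp add: word_def mult_ac)

text \<open>Removing one variable from a nonzero exponent vector lowers \<open>expo_size\<close> by
  one, which gives an induction.\<close>

lemma expo_sequence:
  assumes "Poly_Mapping.keys a \<subseteq> I"
  obtains "is" where "set is \<subseteq> I" "length is = expo_size a"
    "a = sum_list (map (\<lambda>i. Poly_Mapping.single i 1) is)"
proof -
  have "\<exists>is. set is \<subseteq> I \<and> length is = expo_size a \<and> a = sum_list (map (\<lambda>i. Poly_Mapping.single i 1) is)"
    using assms
  proof (induction "expo_size a" arbitrary: a)
    case 0
    then have "a = 0" by (simp add: expo_size_eq_0_iff)
    then show ?case by (intro exI[of _ "[]"]) (simp add: expo_size_def)
  next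
    case (Suc n)
    from Suc.hyps(2) have "a \<noteq> 0" by (auto simp: expo_size_def)
    then obtain i where i: "i \<in> Poly_Mapping.keys a" by (metis ex_in_conv keys_eq_empty)
    define b where "b = a - Poly_Mapping.single i 1"
    have a: "a = Poly_Mapping.single i 1 + b"
      by (rule poly_mapping_eqI)
        (use i in \<open>auto simp: b_def lookup_add lookup_minus lookup_single when_def in_keys_iff\<close>)
    have "Poly_Mapping.keys b \<subseteq> I"
      using Suc.prems keys_diff by (fastforce simp: b_def in_keys_iff lookup_minus)
    moreover have "n = expo_size b"
      using Suc.hyps(2) a by (simp add: expo_size_add)
    ultimately obtain js where "set js \<subseteq> I" "length js = expo_size b"
        "b = sum_list (map (\<lambda>i. Poly_Mapping.single i 1) js)"
      using Suc.hyps(1) by blast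
    then show ?case
      using i Suc.prems a by (intro exI[of _ "i # js"]) (auto simp: expo_size_add)
  qed
  then show ?thesis using that by blast
qed

lemma word_eq_single:
  "word is js = Poly_Mapping.single (sum_list (map (\<lambda>i. Poly_Mapping.single i 1) is),
     sum_list (map (\<lambda>i. Poly_Mapping.single i 1) js)) 1"
proof (induction "is")
  case Nil
  show ?case
    by (induction js) (simp_all add: zvar_def mult_single flip: zero_prod_def)
qed (simp add: yvar_def mult_single)

text \<open>Degree at least 2 excludes the generators, so each basis element that occurs is a
  monomial containing both a \<open>y\<close> and a \<open>z\<close>.\<close>

lemma G_comp_sum_words:
  assumes "f \<in> G_comp d n" "n \<ge> 2"
  obtains P :: "gbasis set" and w v c where "\<forall>p\<in>P. w p \<noteq> [] \<and> v p \<noteq> [] \<and>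
      set (w p) \<subseteq> {1..d} \<and> set (v p) \<subseteq> {1..d} \<and> length (w p) + length (v p) = n"
    "f = of_yz (\<Sum>p\<in>P. Poly_Mapping.single 0 (c p) * word (w p) (v p))"
proof -
  have "\<exists>w v. w \<noteq> [] \<and> v \<noteq> [] \<and> set w \<subseteq> {1..d} \<and> set v \<subseteq> {1..d} \<and> length w + length v = n \<and>
      Poly_Mapping.single p 1 = (of_yz (word w v) :: gbasis \<Rightarrow>\<^sub>0 'a)"
    if "p \<in> Poly_Mapping.keys f" for p
  proof -
    from that assms obtain a b where p: "p = Mon a b" and
      ab: "Poly_Mapping.keys a \<subseteq> {1..d}" "Poly_Mapping.keys b \<subseteq> {1..d}" "expo_size a \<ge> 1"
        "expo_size b \<ge> 1" "expo_size a + expo_size b = n"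
      by (fastforce simp: G_comp_def G_basis_def)
    obtain w where w: "set w \<subseteq> {1..d}" "length w = expo_size a"
        "a = sum_list (map (\<lambda>i. Poly_Mapping.single i 1) w)"
      using expo_sequence[OF ab(1)] by blast
    obtain v where v: "set v \<subseteq> {1..d}" "length v = expo_size b"
        "b = sum_list (map (\<lambda>i. Poly_Mapping.single i 1) v)"
      using expo_sequence[OF ab(2)] by blast
    have "Poly_Mapping.single p 1 = (of_yz (word w v) :: gbasis \<Rightarrow>\<^sub>0 'a)"
      using w(3) v(3) p by (simp add: word_eq_single)
    moreover have "w \<noteq> []" "v \<noteq> []" using w(2) v(2) ab by auto
    ultimately show ?thesis using w v ab by metis
  qed
  then obtain w v where wv: "\<And>p. p \<in> Poly_Mapping.keys f \<Longrightarrow> w p \<noteq> [] \<and> v p \<noteq> [] \<and>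
      set (w p) \<subseteq> {1..d} \<and> set (v p) \<subseteq> {1..d} \<and> length (w p) + length (v p) = n \<and>
      Poly_Mapping.single p 1 = (of_yz (word (w p) (v p)) :: gbasis \<Rightarrow>\<^sub>0 'a)"
    by metis
  have "of_yz (\<Sum>p\<in>Poly_Mapping.keys f. Poly_Mapping.single 0 (Poly_Mapping.lookup f p) * word (w p) (v p))
      = (\<Sum>p\<in>Poly_Mapping.keys f. scale (Poly_Mapping.lookup f p) (Poly_Mapping.single p 1))"
    unfolding of_yz_simps of_yz_const_mult
    by (intro sum.cong refl) (use wv in metis)
  also have "\<dots> = f" by (simp add: poly_mapping_expansion)
  finally show ?thesis using that[of "Poly_Mapping.keys f" w v "Poly_Mapping.lookup f"] wv by simp
qed

lemma gen_in_G_carrier: "i \<in> {1..d} \<Longrightarrow> gen i \<in> G_carrier d"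
  by (simp add: gen_def G_basis_def)

lemma yz_in_G_carrier: "i \<in> {1..d} \<Longrightarrow> j \<in> {1..d} \<Longrightarrow> of_yz (yvar i * zvar j) \<in> G_carrier d"
  by (simp add: yvar_def zvar_def mult_single G_basis_def)

section \<open>Homogeneous elements of degree 2 and 3 as forms with coefficient arrays\<close>

definition quadratic_form :: "nat \<Rightarrow> (nat \<Rightarrow> nat \<Rightarrow> 'k) \<Rightarrow> 'k::field yzpoly" where
  "quadratic_form d A = (\<Sum>i\<in>{1..d}. \<Sum>j\<in>{1..d}. Poly_Mapping.single 0 (A i j) * (yvar i * zvar j))"

text \<open>The arrays need not be symmetric. The quantities that enter the conditions below are the
  sums \<open>A i j k + A j i k\<close>, belonging to \<open>y_i y_j z_k\<close>, and
  \<open>B i j k + B i k j\<close>, belonging to \<open>y_i z_j z_k\<close>.\<close>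

definition cubic_form ::
  "nat \<Rightarrow> (nat \<Rightarrow> nat \<Rightarrow> nat \<Rightarrow> 'k) \<Rightarrow> (nat \<Rightarrow> nat \<Rightarrow> nat \<Rightarrow> 'k) \<Rightarrow> 'k::field yzpoly" where
  "cubic_form d A B = (\<Sum>i\<in>{1..d}. \<Sum>j\<in>{1..d}. \<Sum>k\<in>{1..d}.
     Poly_Mapping.single 0 (A i j k) * (yvar i * yvar j * zvar k) +
     Poly_Mapping.single 0 (B i j k) * (yvar i * zvar j * zvar k))"

lemma sum2_delta:
  fixes c :: "nat \<Rightarrow> nat \<Rightarrow> 'a::comm_ring_1"
  assumes "finite S" "i \<in> S" "j \<in> S"
  shows "(\<Sum>m\<in>S. \<Sum>n\<in>S. c m n * ((if m = i then p else 0) * (if n = j then q else 0))) = c i j * (p * q)"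
proof -
  have "(\<Sum>n\<in>S. c m n * ((if m = i then p else 0) * (if n = j then q else 0))) =
      (if m = i then c m j * (p * q) else 0)" for m
    using assms by (auto simp: if_distrib cong: if_cong)
  then show ?thesis using assms by simp
qed

lemma sum3_delta:
  fixes c :: "nat \<Rightarrow> nat \<Rightarrow> nat \<Rightarrow> 'a::comm_ring_1"
  assumes "finite S" "i \<in> S" "j \<in> S" "k \<in> S"
  shows "(\<Sum>m\<in>S. \<Sum>n\<in>S. \<Sum>l\<in>S. c m n l *
    ((if m = i then p else 0) * (if n = j then q else 0) * (if l = k then r else 0))) = c i j k * (p * q * r)"
proof -
  have "(\<Sum>l\<in>S. c m n l *
      ((if m = i then p else 0) * (if n = j then q else 0) * (if l = k then r else 0))) =
      (c m n k * r) * ((if m = i then p else 0) * (if n = j then q else 0))" for m n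
    using assms by (auto simp: if_distrib mult_ac cong: if_cong)
  then show ?thesis
    by (simp only: sum2_delta[where c = "\<lambda>m n. c m n k * r", OF assms(1,2,3)]) (simp add: mult_ac)
qed

lemma quadratic_form_sum:
  "(\<Sum>p\<in>P. quadratic_form d (A p)) = quadratic_form d (\<lambda>i j. \<Sum>p\<in>P. A p i j)"
  by (induction P rule: infinite_finite_induct)
    (simp_all add: quadratic_form_def single_add algebra_simps sum.distrib)

lemma cubic_form_sum:
  "(\<Sum>p\<in>P. cubic_form d (A p) (B p)) =
   cubic_form d (\<lambda>i j k. \<Sum>p\<in>P. A p i j k) (\<lambda>i j k. \<Sum>p\<in>P. B p i j k)"
  by (induction P rule: infinite_finite_induct)
    (simp_all add: cubic_form_def single_add algebra_simps sum.distrib)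

lemma word2_quadratic_form:
  assumes "w \<noteq> []" "v \<noteq> []" "set w \<subseteq> {1..d}" "set v \<subseteq> {1..d}" "length w + length v = 2"
  shows "\<exists>A. Poly_Mapping.single 0 c * word w v = quadratic_form d A"
proof -
  from assms obtain i j where wv: "w = [i]" "v = [j]" "i \<in> {1..d}" "j \<in> {1..d}"
    by (cases w; cases v) auto
  define A where "A = (\<lambda>m n. if m = i \<and> n = j then c else 0)"
  \<comment> \<open>The constant is moved into the first delta factor, so that
    \<open>yvar m * zvar n\<close> plays the role of the coefficient in
    \<open>sum2_delta\<close>.\<close>
  have "Poly_Mapping.single 0 (A m n) * (yvar m * zvar n) =
      (yvar m * zvar n :: 'a yzpoly) * ((if m = i then Poly_Mapping.single 0 c else 0) * (if n = j then 1 else 0))" for m n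
    by (simp add: A_def mult_ac)
  then have "quadratic_form d A = Poly_Mapping.single 0 c * word w v"
    by (simp only: quadratic_form_def sum2_delta[OF finite_atLeastAtMost wv(3,4)]) (simp add: wv mult_ac)
  then show ?thesis by metis
qed

lemma word3_cubic_form:
  assumes "w \<noteq> []" "v \<noteq> []" "set w \<subseteq> {1..d}" "set v \<subseteq> {1..d}" "length w + length v = 3"
  shows "\<exists>A B. Poly_Mapping.single 0 c * word w v = cubic_form d A B"
proof -
  define D where "D = (\<lambda>(i::nat) (j::nat) (k::nat) m n l. if m = i \<and> n = j \<and> l = k then c else (0::'a))"
  have D: "Poly_Mapping.single 0 (D i j k m n l) * x =
      x * ((if m = i then Poly_Mapping.single 0 c else 0) * (if n = j then 1 else 0) * (if l = k then 1 else 0))"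
    for i j k m n l and x :: "'a yzpoly"
    by (simp add: D_def mult_ac)
  from assms consider
      i j k where "w = [i, j]" "v = [k]" "i \<in> {1..d}" "j \<in> {1..d}" "k \<in> {1..d}"
    | i j k where "w = [i]" "v = [j, k]" "i \<in> {1..d}" "j \<in> {1..d}" "k \<in> {1..d}"
    by (cases w; cases v; cases "tl w"; cases "tl v") auto
  then show ?thesis
  proof cases
    case (1 i j k)
    have "cubic_form d (D i j k) (\<lambda>_ _ _. 0) = Poly_Mapping.single 0 c * word w v"
      by (simp only: cubic_form_def D sum3_delta[OF finite_atLeastAtMost 1(3-5)]
          single_zero mult_zero_left add_0 add_0_right) (simp add: 1 mult_ac)
    then show ?thesis by metis
  next
    case (2 i j k)
    have "cubic_form d (\<lambda>_ _ _. 0) (D i j k) = Poly_Mapping.single 0 c * word w v"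
      by (simp only: cubic_form_def D sum3_delta[OF finite_atLeastAtMost 2(3-5)]
          single_zero mult_zero_left add_0 add_0_right) (simp add: 2 mult_ac)
    then show ?thesis by metis
  qed
qed

lemma G_comp_2_quadratic_form:
  assumes "f \<in> G_comp d 2"
  obtains A where "f = of_yz (quadratic_form d A)"
proof -
  obtain P :: "gbasis set" and w v c where *: "\<forall>p\<in>P. w p \<noteq> [] \<and> v p \<noteq> [] \<and>
      set (w p) \<subseteq> {1..d} \<and> set (v p) \<subseteq> {1..d} \<and> length (w p) + length (v p) = 2"
    "f = of_yz (\<Sum>p\<in>P. Poly_Mapping.single 0 (c p) * word (w p) (v p))"
    by (rule G_comp_sum_words[OF assms order_refl])
  have "\<forall>p\<in>P. \<exists>A. Poly_Mapping.single 0 (c p) * word (w p) (v p) = quadratic_form d A"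
    using word2_quadratic_form *(1) by blast
  then obtain A where "\<And>p. p \<in> P \<Longrightarrow>
      Poly_Mapping.single 0 (c p) * word (w p) (v p) = quadratic_form d (A p)"
    by metis
  then have "f = of_yz (quadratic_form d (\<lambda>i j. \<Sum>p\<in>P. A p i j))"
    unfolding *(2) by (simp only: quadratic_form_sum cong: sum.cong)
  then show ?thesis by (rule that)
qed

lemma G_comp_3_cubic_form:
  assumes "f \<in> G_comp d 3"
  obtains A B where "f = of_yz (cubic_form d A B)"
proof -
  have "(2::nat) \<le> 3" by simp
  then obtain P :: "gbasis set" and w v c where *: "\<forall>p\<in>P. w p \<noteq> [] \<and> v p \<noteq> [] \<and>
      set (w p) \<subseteq> {1..d} \<and> set (v p) \<subseteq> {1..d} \<and> length (w p) + length (v p) = 3"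
    "f = of_yz (\<Sum>p\<in>P. Poly_Mapping.single 0 (c p) * word (w p) (v p))"
    by (rule G_comp_sum_words[OF assms])
  have "\<forall>p\<in>P. \<exists>A B. Poly_Mapping.single 0 (c p) * word (w p) (v p) = cubic_form d A B"
    using word3_cubic_form *(1) by blast
  then obtain A B where "\<And>p. p \<in> P \<Longrightarrow>
      Poly_Mapping.single 0 (c p) * word (w p) (v p) = cubic_form d (A p) (B p)"
    by metis
  then have "f = of_yz (cubic_form d (\<lambda>i j k. \<Sum>p\<in>P. A p i j k) (\<lambda>i j k. \<Sum>p\<in>P. B p i j k))"
    unfolding *(2) by (simp only: cubic_form_sum cong: sum.cong)
  then show ?thesis by (rule that)
qed

subsection \<open>T-ideals containing the defining identity\<close>

text \<open>\<open>J\<close> is kept arbitrary because the locale is used twice: for the T-ideal of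
  the variety itself and for preimages of T-ideals of the quotient.\<close>

locale U_T_ideal =
  fixes d :: nat and \<alpha> :: "'k::field_char_0" and J :: "(gbasis \<Rightarrow>\<^sub>0 'k) set"
  assumes T_ideal_J: "T_ideal (G_alg d) J"
    and U_poly_in_J: "U_poly \<alpha> \<alpha> \<in> J"
    and alpha_nonzero: "\<alpha> \<noteq> 0"
begin

lemma J_closed:
  "0 \<in> J" "u \<in> J \<Longrightarrow> v \<in> J \<Longrightarrow> u + v \<in> J" "u \<in> J \<Longrightarrow> scale c u \<in> J"
  "u \<in> J \<Longrightarrow> f \<in> G_carrier d \<Longrightarrow> G_mult f u \<in> J"
  "u \<in> J \<Longrightarrow> f \<in> G_carrier d \<Longrightarrow> G_mult u f \<in> J"
  using T_ideal_J unfolding T_ideal_def na_ideal_def by auto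

lemma G_subst_in_J: "u \<in> J \<Longrightarrow> (\<And>i. \<sigma> i \<in> G_carrier d) \<Longrightarrow> G_subst \<sigma> u \<in> J"
  using T_ideal_J na_endo_G_subst[of \<sigma> d] unfolding T_ideal_def by blast

text \<open>Working with the preimage of \<open>J\<close> under \<open>of_yz\<close> turns all
  computations into identities of commutative polynomials.\<close>

definition V :: "'k yzpoly set" where
  "V = {x. of_yz x \<in> J}"

lemma V_add: "x \<in> V \<Longrightarrow> y \<in> V \<Longrightarrow> x + y \<in> V"
  by (simp add: V_def J_closed)

lemma V_const: "x \<in> V \<Longrightarrow> Poly_Mapping.single 0 c * x \<in> V"
  by (simp add: V_def J_closed of_yz_const_mult)

lemma V_zero: "0 \<in> V"
  by (simp add: V_def J_closed)

lemma V_sum: "(\<And>i. i \<in> I \<Longrightarrow> F i \<in> V) \<Longrightarrow> (\<Sum>i\<in>I. F i) \<in> V"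
  by (induction I rule: infinite_finite_induct) (auto simp: V_zero intro: V_add)

lemma V_numeral: "x \<in> V \<Longrightarrow> numeral n * x \<in> V"
  using V_const[of x "numeral n"] by simp

lemma V_diff: "x \<in> V \<Longrightarrow> y \<in> V \<Longrightarrow> x - y \<in> V"
  using V_add[OF _ V_const[of y "- 1"], of x] by (simp add: single_uminus)

lemma V_const_cancel:
  assumes "Poly_Mapping.single 0 c * x \<in> V" "c \<noteq> 0"
  shows "x \<in> V"
proof -
  have "Poly_Mapping.single 0 (inverse c) * (Poly_Mapping.single 0 c * x) \<in> V"
    using assms(1) by (rule V_const)
  then show ?thesis using assms(2) by (simp add: mult_single flip: mult.assoc)
qed

text \<open>Division by integers, which is where characteristic 0 enters.\<close>

lemma V_numeral_cancel: "numeral n * x \<in> V \<Longrightarrow> x \<in> V"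
  using V_const_cancel[of "numeral n" x] by simp

lemma V_yvar: "x \<in> V \<Longrightarrow> i \<in> {1..d} \<Longrightarrow> yvar i * x \<in> V"
  using J_closed(4)[OF _ gen_in_G_carrier, of "of_yz x" i] by (simp add: V_def G_mult_eq)

lemma V_zvar: "x \<in> V \<Longrightarrow> i \<in> {1..d} \<Longrightarrow> zvar i * x \<in> V"
  using J_closed(5)[OF _ gen_in_G_carrier, of "of_yz x" i] by (simp add: V_def G_mult_eq mult.commute)

lemma V_subst: "x \<in> V \<Longrightarrow> (\<And>i. \<sigma> i \<in> G_carrier d) \<Longrightarrow> yz_subst \<sigma> x \<in> V"
  using G_subst_in_J[of "of_yz x" \<sigma>] by (simp add: V_def G_subst_of_yz)

lemmas V_intros = V_add V_diff V_numeral

lemma G_comp_subset_J: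
  assumes "n \<ge> 2" and "\<And>w v. w \<noteq> [] \<Longrightarrow> v \<noteq> [] \<Longrightarrow> set w \<subseteq> {1..d} \<Longrightarrow> set v \<subseteq> {1..d} \<Longrightarrow>
    length w + length v = n \<Longrightarrow> word w v \<in> V"
  shows "G_comp d n \<subseteq> J"
proof
  fix f :: "gbasis \<Rightarrow>\<^sub>0 'k" assume "f \<in> G_comp d n"
  then obtain P :: "gbasis set" and w v c where *: "\<forall>p\<in>P. w p \<noteq> [] \<and> v p \<noteq> [] \<and>
      set (w p) \<subseteq> {1..d} \<and> set (v p) \<subseteq> {1..d} \<and> length (w p) + length (v p) = n"
    "f = of_yz (\<Sum>p\<in>P. Poly_Mapping.single 0 (c p) * word (w p) (v p))"
    by (rule G_comp_sum_words[OF _ assms(1)])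
  have "(\<Sum>p\<in>P. Poly_Mapping.single 0 (c p) * word (w p) (v p)) \<in> V"
    by (intro V_sum V_const assms(2)) (use *(1) in auto)
  then show "f \<in> J" using *(2) by (simp add: V_def)
qed

section \<open>The polarised defining identity and the relations in degree 4\<close>

lemma polarised_identity:
  assumes "g \<in> G_carrier d" "h \<in> G_carrier d" "k \<in> G_carrier d"
  defines "a \<equiv> left_poly g" and "a' \<equiv> right_poly g" and "b \<equiv> left_poly h" and "b' \<equiv> right_poly h"
    and "c \<equiv> left_poly k" and "c' \<equiv> right_poly k"
  shows "a * b * c' + a * c * b' + b * c * a' + a * b' * c' + b * a' * c' + c * a' * b' \<in> V"
proof -
  define x where "x = Poly_Mapping.single 0 \<alpha> * (yvar 1 * yvar 1 * zvar 1 + yvar 1 * zvar 1 * zvar 1)"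
  have "of_yz x = U_poly \<alpha> \<alpha>"
    unfolding x_def U_poly_def of_yz_const_mult
    by (simp add: yvar_def zvar_def mult_single flip: single_add) (simp add: scale_add numeral_2_eq_2 one_add_one)
  then have x: "x \<in> V" using U_poly_in_J by (simp add: V_def)
  \<comment> \<open>Only \<open>y_1\<close> and \<open>z_1\<close> occur in \<open>x\<close>, so the
    constant assignment with value \<open>f\<close> suffices.\<close>
  have sq: "left_poly f * left_poly f * right_poly f + left_poly f * right_poly f * right_poly f \<in> V"
    if "f \<in> G_carrier d" for f
    using V_subst[OF x, of "\<lambda>_. f"] that alpha_nonzero unfolding x_def
    by (auto simp: yz_subst_mult intro: V_const_cancel)
  define F where "F = (\<lambda>(a::'k yzpoly) b. a * a * b + a * b * b)"
  have F: "F (left_poly f) (right_poly f) \<in> V" if "f \<in> G_carrier d" for f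
    using sq[OF that] by (simp add: F_def)
  have G: "g + h \<in> G_carrier d" "g + k \<in> G_carrier d" "h + k \<in> G_carrier d" "g + h + k \<in> G_carrier d"
    using G_carrier_closed(1)[OF assms(1,2)] G_carrier_closed(1)[OF assms(1,3)]
      G_carrier_closed(1)[OF assms(2,3)] G_carrier_closed(1)[OF G_carrier_closed(1)[OF assms(1,2)] assms(3)]
    by simp_all
  \<comment> \<open>Inclusion-exclusion leaves the part that is linear in each of the pairs
    \<open>(a, a')\<close>, \<open>(b, b')\<close>, \<open>(c, c')\<close>, which is twice the
    claimed expression.\<close>
  have "F (a + b + c) (a' + b' + c') - F (a + b) (a' + b') - F (a + c) (a' + c') - F (b + c) (b' + c')
      + F a a' + F b b' + F c c' \<in> V"
    using F[OF G(1)] F[OF G(2)] F[OF G(3)] F[OF G(4)] F[OF assms(1)] F[OF assms(2)] F[OF assms(3)]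
    unfolding a_def a'_def b_def b'_def c_def c'_def by (intro V_intros) simp_all
  also have "F (a + b + c) (a' + b' + c') - F (a + b) (a' + b') - F (a + c) (a' + c') - F (b + c) (b' + c')
      + F a a' + F b b' + F c c' = 
      2 * (a * b * c' + a * c * b' + b * c * a' + a * b' * c' + b * a' * c' + c * a' * b')"
    unfolding F_def by (simp add: algebra_simps)
  finally show ?thesis by (rule V_numeral_cancel)
qed

lemma cubic_identity:
  assumes "i \<in> {1..d}" "j \<in> {1..d}" "k \<in> {1..d}"
  shows "yvar i * yvar j * zvar k + yvar i * yvar k * zvar j + yvar j * yvar k * zvar i
    + yvar i * zvar j * zvar k + yvar j * zvar i * zvar k + yvar k * zvar i * zvar j \<in> V"
  using polarised_identity[OF assms[THEN gen_in_G_carrier]] by simp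

text \<open>One argument of the polarised identity is the product \<open>y_i z_j\<close>, whose two
  coordinates coincide; two pairs of terms therefore merge, which explains the coefficients
  2.\<close>

lemma quartic_identity:
  assumes "i \<in> {1..d}" "j \<in> {1..d}" "k \<in> {1..d}" "l \<in> {1..d}"
  shows "yvar i * zvar j * (yvar k * yvar l + zvar k * zvar l + 2 * yvar k * zvar l + 2 * yvar l * zvar k) \<in> V"
  using polarised_identity[OF yz_in_G_carrier[OF assms(1,2)] assms(3,4)[THEN gen_in_G_carrier]]
  by (simp add: algebra_simps)

text \<open>With \<open>S\<close> the sum in the first relation, the second and third relations are
  first obtained only up to \<open>S\<close> (as \<open>W\<close> and \<open>N\<close>). Combining
  these with a further multiple of the cubic identity shows that \<open>S\<close> itself lies in
  \<open>V\<close>.\<close>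

lemma degree_4_relations:
  assumes "i \<in> {1..d}" "j \<in> {1..d}" "k \<in> {1..d}" "l \<in> {1..d}"
  shows degree_4_sum: "yvar j * yvar k * yvar l * zvar i + yvar i * yvar k * yvar l * zvar j
      + yvar i * yvar j * yvar l * zvar k + yvar i * yvar j * yvar k * zvar l \<in> V" (is ?A)
    and degree_4_zzz: "yvar i * zvar j * zvar k * zvar l + yvar j * yvar k * yvar l * zvar i \<in> V" (is ?B)
    and degree_4_yyzz: "2 * (yvar i * yvar j * zvar k * zvar l)
      - yvar j * yvar k * yvar l * zvar i - yvar i * yvar k * yvar l * zvar j \<in> V" (is ?C)
proof -
  define S where "S = (\<lambda>i j k l. yvar j * yvar k * yvar l * zvar i + yvar i * yvar k * yvar l * zvar j
      + yvar i * yvar j * yvar l * zvar k + yvar i * yvar j * yvar k * (zvar l :: 'k yzpoly))"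
  define Q where "Q = (\<lambda>i j k l. yvar i * zvar j * (yvar k * yvar l + zvar k * zvar l
      + 2 * yvar k * zvar l + 2 * yvar l * (zvar k :: 'k yzpoly)))"
  define E where "E = (\<lambda>i j k. yvar i * yvar j * zvar k + yvar i * yvar k * zvar j + yvar j * yvar k * zvar i
    + yvar i * zvar j * zvar k + yvar j * zvar i * zvar k + yvar k * zvar i * (zvar j :: 'k yzpoly))"
  define W where "W = (\<lambda>i j k l. yvar i * zvar j * zvar k * zvar l + yvar j * yvar k * yvar l * zvar i - S i j k l)"
  define N where "N = (\<lambda>i j k l. yvar j * yvar k * yvar l * zvar i + yvar i * yvar k * yvar l * zvar j
    - 2 * (yvar i * yvar j * zvar k * zvar l) - S i j k l)"
  have Q: "Q i j k l \<in> V" if "i \<in> {1..d}" "j \<in> {1..d}" "k \<in> {1..d}" "l \<in> {1..d}" for i j k l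
    using quartic_identity[OF that] by (simp add: Q_def)
  have E: "E i j k \<in> V" if "i \<in> {1..d}" "j \<in> {1..d}" "k \<in> {1..d}" for i j k
    using cubic_identity[OF that] by (simp add: E_def)
  have W: "W i j k l \<in> V" if I: "i \<in> {1..d}" "j \<in> {1..d}" "k \<in> {1..d}" "l \<in> {1..d}" for i j k l
  proof -
    \<comment> \<open>Summing over the choice of the factor \<open>z\<close> paired with
      \<open>y_i\<close> gives every \<open>y y z z\<close> monomial the coefficient 4, so
      \<open>4 * (yvar i * E j k l)\<close> removes them all.\<close>
    have "Q i j k l + Q i k j l + Q i l j k - 4 * (yvar i * E j k l) \<in> V"
      using I by (intro V_intros Q E V_yvar)
    also have "Q i j k l + Q i k j l + Q i l j k - 4 * (yvar i * E j k l) = 3 * W i j k l"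
      unfolding Q_def E_def W_def S_def by (simp add: algebra_simps)
    finally show ?thesis by (rule V_numeral_cancel)
  qed
  have N: "N i j k l \<in> V" if I: "i \<in> {1..d}" "j \<in> {1..d}" "k \<in> {1..d}" "l \<in> {1..d}" for i j k l
  proof -
    \<comment> \<open>Of the three \<open>y y z z\<close> monomials in
      \<open>yvar i * E j k l\<close>, two cancel against \<open>Q i j k l\<close>; the one left is
      \<open>y_i y_j z_k z_l\<close>.\<close>
    have "Q i j k l - 2 * (yvar i * E j k l) - W i j k l \<in> V"
      using I by (intro V_intros Q E W V_yvar)
    also have "Q i j k l - 2 * (yvar i * E j k l) - W i j k l = N i j k l"
      unfolding Q_def E_def W_def S_def N_def by (simp add: algebra_simps)
    finally show ?thesis .
  qed
  \<comment> \<open>The three \<open>N\<close> cancel the \<open>y y z z\<close> terms of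
    \<open>2 * (zvar l * E i j k)\<close>, the three \<open>W\<close> its \<open>y z z z\<close>
    terms; what remains is a multiple of \<open>S\<close>.\<close>
  have "2 * (zvar l * E i j k) + N i j k l + N i k j l + N j k i l
      - 2 * (W i j k l + W j i k l + W k i j l) \<in> V"
    using assms by (intro V_intros E W N V_zvar)
  also have "2 * (zvar l * E i j k) + N i j k l + N i k j l + N j k i l
      - 2 * (W i j k l + W j i k l + W k i j l) = 3 * S i j k l"
    unfolding E_def W_def S_def N_def by (simp add: algebra_simps)
  finally have S: "S i j k l \<in> V" by (rule V_numeral_cancel)
  then show ?A by (simp add: S_def)
  from V_add[OF W[OF assms] S] show ?B by (simp add: W_def)
  have "0 - (N i j k l + S i j k l) \<in> V" by (intro V_intros V_zero N S assms)
  then show ?C by (simp add: N_def algebra_simps)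
qed

section \<open>Vanishing in degree at least 5\<close>

lemma degree_5_word:
  assumes "i \<in> {1..d}" "j \<in> {1..d}" "k \<in> {1..d}" "l \<in> {1..d}" "m \<in> {1..d}"
  shows "yvar i * yvar j * yvar k * yvar l * zvar m \<in> V"
    and "yvar i * yvar j * zvar k * zvar l * zvar m \<in> V"
    and "yvar i * zvar j * zvar k * zvar l * zvar m \<in> V"
    and "yvar i * yvar j * yvar k * zvar l * zvar m \<in> V"
proof -
  have R: "yvar i * zvar j * zvar k * zvar l + yvar j * yvar k * yvar l * zvar i \<in> V"
    if "i \<in> {1..d}" "j \<in> {1..d}" "k \<in> {1..d}" "l \<in> {1..d}" for i j k l
    using degree_4_zzz[OF that] .
  have y4z: "yvar i * yvar j * yvar k * yvar l * zvar m \<in> V"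
    if I: "i \<in> {1..d}" "j \<in> {1..d}" "k \<in> {1..d}" "l \<in> {1..d}" "m \<in> {1..d}" for i j k l m
  proof -
    define s where "s = (\<lambda>i j k l m. yvar j * yvar k * yvar l * yvar m * (zvar i :: 'k yzpoly))"
    have D: "s i j k l m - s m j k l i \<in> V"
      if I: "i \<in> {1..d}" "j \<in> {1..d}" "k \<in> {1..d}" "l \<in> {1..d}" "m \<in> {1..d}" for i j k l m
    proof -
      \<comment> \<open>Both products contain \<open>y_i y_m z_j z_k z_l\<close>; its cancellation
        exchanges the index of the single \<open>z\<close> with that of a \<open>y\<close>.\<close>
      have "yvar m * (yvar i * zvar j * zvar k * zvar l + yvar j * yvar k * yvar l * zvar i)
          - yvar i * (yvar m * zvar j * zvar k * zvar l + yvar j * yvar k * yvar l * zvar m) \<in> V"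
        using I by (intro V_intros V_yvar R)
      then show ?thesis by (simp add: s_def algebra_simps)
    qed
    \<comment> \<open>The degree 4 sum for \<open>i\<close>, \<open>j\<close>, \<open>k\<close>,
      \<open>m\<close> times \<open>y_l\<close> has four terms; the three differences turn each of
      the others into the term with \<open>z_m\<close>.\<close>
    have "(s m j k l i - s i j k l m) + (s m i k l j - s j i k l m) + (s m i j l k - s k i j l m)
        + yvar l * (yvar j * yvar k * yvar m * zvar i + yvar i * yvar k * yvar m * zvar j
      + yvar i * yvar j * yvar m * zvar k + yvar i * yvar j * yvar k * zvar m) \<in> V"
      using I by (intro V_add[OF V_add[OF V_add]] V_yvar D degree_4_sum)
    then have "4 * s m i j k l \<in> V"
      by (simp add: s_def algebra_simps)
    then show ?thesis using V_numeral_cancel by (fastforce simp: s_def)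
  qed
  then show "yvar i * yvar j * yvar k * yvar l * zvar m \<in> V" using assms by blast
  have "yvar j * (yvar i * zvar k * zvar l * zvar m + yvar k * yvar l * yvar m * zvar i)
      - yvar j * yvar k * yvar l * yvar m * zvar i \<in> V"
    using assms by (intro V_intros V_yvar R y4z)
  then show "yvar i * yvar j * zvar k * zvar l * zvar m \<in> V" by (simp add: algebra_simps)
  have yz4: "yvar i * zvar j * zvar k * zvar l * zvar m \<in> V"
    if I: "i \<in> {1..d}" "j \<in> {1..d}" "k \<in> {1..d}" "l \<in> {1..d}" "m \<in> {1..d}" for i j k l m
  proof -
    define t where "t = (\<lambda>i j k l m. yvar i * zvar j * zvar k * zvar l * (zvar m :: 'k yzpoly))"
    have D: "t i j k l m - t m j k l i \<in> V"
      if I: "i \<in> {1..d}" "j \<in> {1..d}" "k \<in> {1..d}" "l \<in> {1..d}" "m \<in> {1..d}" for i j k l m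
    proof -
      have "zvar m * (yvar i * zvar j * zvar k * zvar l + yvar j * yvar k * yvar l * zvar i)
          - zvar i * (yvar m * zvar j * zvar k * zvar l + yvar j * yvar k * yvar l * zvar m) \<in> V"
        using I by (intro V_intros V_zvar R)
      then show ?thesis by (simp add: t_def algebra_simps)
    qed
    \<comment> \<open>Mirror image of \<open>degree_4_sum\<close>: the second relation replaces each
      monomial with a single \<open>z\<close> by minus the one with a single
      \<open>y\<close>.\<close>
    have S: "yvar i * zvar j * zvar k * zvar l + yvar j * zvar i * zvar k * zvar l
        + yvar k * zvar i * zvar j * zvar l + yvar l * zvar i * zvar j * zvar k \<in> V"
    proof -
      have "(yvar i * zvar j * zvar k * zvar l + yvar j * yvar k * yvar l * zvar i)
        + (yvar j * zvar i * zvar k * zvar l + yvar i * yvar k * yvar l * zvar j)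
        + (yvar k * zvar i * zvar j * zvar l + yvar i * yvar j * yvar l * zvar k)
        + (yvar l * zvar i * zvar j * zvar k + yvar i * yvar j * yvar k * zvar l)
        - (yvar j * yvar k * yvar l * zvar i + yvar i * yvar k * yvar l * zvar j
      + yvar i * yvar j * yvar l * zvar k + yvar i * yvar j * yvar k * zvar l) \<in> V"
        using I by (intro V_intros R degree_4_sum)
      then show ?thesis by (simp add: algebra_simps)
    qed
    have "(t i m k l j - t j m k l i) + (t i m j l k - t k m j l i) + (t i m j k l - t l m j k i)
        + zvar m * (yvar i * zvar j * zvar k * zvar l + yvar j * zvar i * zvar k * zvar l
        + yvar k * zvar i * zvar j * zvar l + yvar l * zvar i * zvar j * zvar k) \<in> V"
      using I by (intro V_add[OF V_add[OF V_add]] V_zvar D S)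
    then have "4 * t i j k l m \<in> V"
      by (simp add: t_def algebra_simps)
    then show ?thesis using V_numeral_cancel by (fastforce simp: t_def)
  qed
  then show "yvar i * zvar j * zvar k * zvar l * zvar m \<in> V" using assms by blast
  \<comment> \<open>The second relation times \<open>z_m\<close> expresses a
    \<open>y y y z z\<close> monomial through a \<open>y z z z z\<close> monomial, which is already
    known to lie in \<open>V\<close>.\<close>
  have "zvar m * (yvar l * zvar i * zvar j * zvar k + yvar i * yvar j * yvar k * zvar l)
      - yvar l * zvar i * zvar j * zvar k * zvar m \<in> V"
    using assms by (intro V_intros V_zvar R yz4)
  then show "yvar i * yvar j * yvar k * zvar l * zvar m \<in> V" by (simp add: algebra_simps)
qed

text \<open>A word of length above 5 has at least two letters on one side; removing one of them
  keeps both sides nonempty, and \<open>V\<close> is closed under multiplication by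
  variables.\<close>

lemma long_word_in_V:
  assumes "w \<noteq> []" "v \<noteq> []" "set w \<subseteq> {1..d}" "set v \<subseteq> {1..d}" "length w + length v \<ge> 5"
  shows "word w v \<in> V"
  using assms
proof (induction "length w + length v" arbitrary: w v rule: less_induct)
  case less
  show ?case
  proof (cases "length w + length v = 5")
    case True
    moreover have "length w \<noteq> 0" "length v \<noteq> 0" using less.prems by auto
    ultimately consider "length w = 1" "length v = 4" | "length w = 2" "length v = 3"
      | "length w = 3" "length v = 2" | "length w = 4" "length v = 1"
      by linarith
    then show ?thesis
      using less.prems
      by cases (auto simp: length_Suc_conv eval_nat_numeral intro!: degree_5_word[unfolded mult.assoc])
  next
    case False
    then consider i w' where "w = i # w'" "w' \<noteq> []" | j v' where "v = j # v'" "v' \<noteq> []"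
      using less.prems by (cases w; cases v; cases "tl w"; cases "tl v") auto
    then show ?thesis
    proof cases
      case 1
      then show ?thesis using less False by (auto intro!: V_yvar)
    next
      case 2
      then show ?thesis using less False by (auto simp: word_Cons_right intro!: V_zvar)
    qed
  qed
qed

lemma G_comp_ge_5: "n \<ge> 5 \<Longrightarrow> G_comp d n \<subseteq> J"
  by (rule G_comp_subset_J) (simp_all add: long_word_in_V)

text \<open>By the second and third degree 4 relations the monomials of the other two shapes are
  combinations of those with a single \<open>z\<close>.\<close>

lemma G_comp_4_subset_J:
  assumes v: "\<And>i j k l. i \<in> {1..d} \<Longrightarrow> j \<in> {1..d} \<Longrightarrow> k \<in> {1..d} \<Longrightarrow> l \<in> {1..d} \<Longrightarrow>
      yvar i * yvar j * yvar k * zvar l \<in> V"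
  shows "G_comp d 4 \<subseteq> J"
proof (rule G_comp_subset_J)
  have yzzz: "yvar i * zvar j * zvar k * zvar l \<in> V"
    if I: "i \<in> {1..d}" "j \<in> {1..d}" "k \<in> {1..d}" "l \<in> {1..d}" for i j k l
    using V_diff[OF degree_4_zzz[OF I] v[OF I(2-4,1)]] by simp
  have yyzz: "yvar i * yvar j * zvar k * zvar l \<in> V"
    if I: "i \<in> {1..d}" "j \<in> {1..d}" "k \<in> {1..d}" "l \<in> {1..d}" for i j k l
  proof (rule V_numeral_cancel)
    show "2 * (yvar i * yvar j * zvar k * zvar l) \<in> V"
      using V_add[OF V_add[OF degree_4_yyzz[OF I] v[OF I(1,3,4,2)]] v[OF I(2-4,1)]] by simp
  qed
  fix w v :: "nat list"
  assume wv: "w \<noteq> []" "v \<noteq> []" "set w \<subseteq> {1..d}" "set v \<subseteq> {1..d}" "length w + length v = 4"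
  moreover have "length w \<noteq> 0" "length v \<noteq> 0" using wv by auto
  ultimately consider "length w = 1" "length v = 3" | "length w = 2" "length v = 2"
    | "length w = 3" "length v = 1"
    by linarith
  then show "word w v \<in> V"
    using wv
    by cases (auto simp: length_Suc_conv eval_nat_numeral
        intro!: yzzz[unfolded mult.assoc] yyzz[unfolded mult.assoc] assms[unfolded mult.assoc])
qed simp

lemma G_comp_3_subset_J:
  assumes yyz: "\<And>i j k. i \<in> {1..d} \<Longrightarrow> j \<in> {1..d} \<Longrightarrow> k \<in> {1..d} \<Longrightarrow> yvar i * yvar j * zvar k \<in> V"
    and yzz: "\<And>i j k. i \<in> {1..d} \<Longrightarrow> j \<in> {1..d} \<Longrightarrow> k \<in> {1..d} \<Longrightarrow> yvar i * zvar j * zvar k \<in> V"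
  shows "G_comp d 3 \<subseteq> J"
proof (rule G_comp_subset_J)
  fix w v :: "nat list"
  assume wv: "w \<noteq> []" "v \<noteq> []" "set w \<subseteq> {1..d}" "set v \<subseteq> {1..d}" "length w + length v = 3"
  moreover have "length w \<noteq> 0" "length v \<noteq> 0" using wv by auto
  ultimately consider "length w = 1" "length v = 2" | "length w = 2" "length v = 1"
    by linarith
  then show "word w v \<in> V"
    using wv
    by cases (auto simp: length_Suc_conv eval_nat_numeral
        intro!: yyz[unfolded mult.assoc] yzz[unfolded mult.assoc])
qed simp

section \<open>Consequences of elements of degree 1, 2 and 3\<close>

lemma degree_1_consequences:
  assumes "f \<in> J" "f \<in> G_comp d 1" "f \<noteq> 0"
  shows "G_carrier d \<subseteq> J"
proof
  fix g :: "gbasis \<Rightarrow>\<^sub>0 'k" assume g: "g \<in> G_carrier d"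
  have gens: "\<exists>i\<in>{1..d}. p = Gen i" if "p \<in> Poly_Mapping.keys f" for p
    using that assms(2) by (fastforce simp: G_comp_def G_basis_def)
  from assms(3) obtain p where "p \<in> Poly_Mapping.keys f"
    by (metis ex_in_conv keys_eq_empty)
  with gens obtain i where i: "Gen i \<in> Poly_Mapping.keys f" by blast
  \<comment> \<open>A generator with nonzero coefficient goes to \<open>g\<close> and all others to
    0, so \<open>f\<close> becomes a nonzero multiple of \<open>g\<close>.\<close>
  define \<sigma> where "\<sigma> = (\<lambda>m. if m = i then g else 0)"
  have "G_subst \<sigma> f = (\<Sum>p\<in>Poly_Mapping.keys f. if p = Gen i then scale (Poly_Mapping.lookup f p) g else 0)"
    unfolding G_subst_def lin_ext_def by (intro sum.cong refl) (auto dest!: gens simp: \<sigma>_def split: if_splits)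
  then have "G_subst \<sigma> f = scale (Poly_Mapping.lookup f (Gen i)) g"
    using i by simp
  moreover have "G_subst \<sigma> f \<in> J"
    using assms(1) g by (intro G_subst_in_J) (auto simp: \<sigma>_def)
  ultimately have "scale (inverse (Poly_Mapping.lookup f (Gen i)) * Poly_Mapping.lookup f (Gen i)) g \<in> J"
    using J_closed(3) by (metis scale_scale)
  then show "g \<in> J" using i by (simp add: in_keys_iff)
qed

text \<open>Substitute \<open>g\<close> for \<open>x_i\<close>, \<open>h\<close> for
  \<open>x_j\<close> and 0 elsewhere, and keep the mixed part. The assignment is a sum of two delta
  functions, so the case \<open>i = j\<close> is covered, with \<open>x_i\<close> going to
  \<open>g + h\<close>.\<close>

lemma quadratic_polarisation:
  assumes "quadratic_form d A \<in> V" and ij: "i \<in> {1..d}" "j \<in> {1..d}"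
    and gh: "g \<in> G_carrier d" "h \<in> G_carrier d"
  shows "Poly_Mapping.single 0 (A i j) * (left_poly g * right_poly h) +
    Poly_Mapping.single 0 (A j i) * (left_poly h * right_poly g) \<in> V"
proof -
  define \<delta> where "\<delta> = (\<lambda>(i::nat) (x::'k yzpoly) m. if m = i then x else 0)"
  define F where "F = (\<lambda>a a'. \<Sum>m\<in>{1..d}. \<Sum>n\<in>{1..d}. Poly_Mapping.single 0 (A m n) * (a m * (a' n :: 'k yzpoly)))"
  have F: "F (\<lambda>m. left_poly (\<sigma> m)) (\<lambda>m. right_poly (\<sigma> m)) \<in> V" if "\<And>m. \<sigma> m \<in> G_carrier d" for \<sigma>
    using V_subst[OF assms(1) that] by (simp add: F_def quadratic_form_def yz_subst_mult)
  define \<gamma> where "\<gamma> = (\<lambda>(i::nat) (x::gbasis \<Rightarrow>\<^sub>0 'k) m. if m = i then x else 0)"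
  have \<gamma>: "\<gamma> i x m \<in> G_carrier d" if "x \<in> G_carrier d" for i x m
    using that by (simp add: \<gamma>_def)
  have lr: "left_poly (\<gamma> i x m) = \<delta> i (left_poly x) m" "right_poly (\<gamma> i x m) = \<delta> i (right_poly x) m" for i x m
    by (simp_all add: \<gamma>_def \<delta>_def)
  let ?a = "\<delta> i (left_poly g)" and ?a' = "\<delta> i (right_poly g)"
  let ?b = "\<delta> j (left_poly h)" and ?b' = "\<delta> j (right_poly h)"
  have "F (\<lambda>m. ?a m + ?b m) (\<lambda>m. ?a' m + ?b' m) - F ?a ?a' - F ?b ?b' \<in> V"
    using F[of "\<lambda>m. \<gamma> i g m + \<gamma> j h m"] F[of "\<gamma> i g"] F[of "\<gamma> j h"]
      G_carrier_closed(1)[OF \<gamma>[OF gh(1)] \<gamma>[OF gh(2)]] \<gamma>[OF gh(1)] \<gamma>[OF gh(2)]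
    unfolding left_poly_simps right_poly_simps lr by (intro V_diff) blast+
  also have "F (\<lambda>m. ?a m + ?b m) (\<lambda>m. ?a' m + ?b' m) - F ?a ?a' - F ?b ?b' = F ?a ?b' + F ?b ?a'"
    unfolding F_def by (simp add: algebra_simps sum.distrib)
  also have "\<dots> = Poly_Mapping.single 0 (A i j) * (left_poly g * right_poly h) +
      Poly_Mapping.single 0 (A j i) * (left_poly h * right_poly g)"
    unfolding F_def \<delta>_def sum2_delta[OF finite_atLeastAtMost ij] sum2_delta[OF finite_atLeastAtMost ij(2,1)] ..
  finally show ?thesis .
qed

text \<open>Inclusion-exclusion over the assignments \<open>x_i\<close> to \<open>x_p\<close>,
  \<open>x_j\<close> to \<open>x_q\<close>, \<open>x_k\<close> to \<open>x_r\<close>, where images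
  are added if indices coincide. The coefficients depend on \<open>i\<close>, \<open>j\<close>,
  \<open>k\<close> only, so one relation holds for all triples \<open>p\<close>, \<open>q\<close>,
  \<open>r\<close>.\<close>

lemma cubic_polarisation:
  assumes "cubic_form d A B \<in> V" and ijk: "i \<in> {1..d}" "j \<in> {1..d}" "k \<in> {1..d}"
    and pqr: "p \<in> {1..d}" "q \<in> {1..d}" "r \<in> {1..d}"
  shows "Poly_Mapping.single 0 (A i j k + A j i k) * (yvar p * yvar q * zvar r)
    + Poly_Mapping.single 0 (A i k j + A k i j) * (yvar p * yvar r * zvar q)
    + Poly_Mapping.single 0 (A j k i + A k j i) * (yvar q * yvar r * zvar p)
    + Poly_Mapping.single 0 (B i j k + B i k j) * (yvar p * zvar q * zvar r)
    + Poly_Mapping.single 0 (B j i k + B j k i) * (yvar q * zvar p * zvar r)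
    + Poly_Mapping.single 0 (B k i j + B k j i) * (yvar r * zvar p * zvar q) \<in> V"
proof -
  define \<delta> where "\<delta> = (\<lambda>(i::nat) (x::'k yzpoly) m. if m = i then x else 0)"
  define F where "F = (\<lambda>C a b c. \<Sum>l\<in>{1..d}. \<Sum>m\<in>{1..d}. \<Sum>n\<in>{1..d}.
    Poly_Mapping.single 0 (C l m n) * (a l * b m * (c n :: 'k yzpoly)))"
  define H where "H = (\<lambda>a a'. F A a a a' + F B a a' a')"
  have H: "H (\<lambda>m. left_poly (\<sigma> m)) (\<lambda>m. right_poly (\<sigma> m)) \<in> V" if "\<And>m. \<sigma> m \<in> G_carrier d" for \<sigma>
    using V_subst[OF assms(1) that] by (simp add: F_def H_def cubic_form_def yz_subst_mult sum.distrib)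
  define \<gamma> where "\<gamma> = (\<lambda>(i::nat) p m. if m = i then (gen p :: gbasis \<Rightarrow>\<^sub>0 'k) else 0)"
  have lr: "left_poly (\<gamma> i p m) = \<delta> i (yvar p) m" "right_poly (\<gamma> i p m) = \<delta> i (zvar p) m" for i p m
    by (simp_all add: \<gamma>_def \<delta>_def)
  have \<gamma>: "\<gamma> i p m \<in> G_carrier d" if "p \<in> {1..d}" for i p m
    using that by (auto simp: \<gamma>_def gen_def G_basis_def)
  note \<gamma>s = \<gamma>[OF pqr(1)] \<gamma>[OF pqr(2)] \<gamma>[OF pqr(3)]
  let ?a = "\<delta> i (yvar p)" and ?a' = "\<delta> i (zvar p)"
  let ?b = "\<delta> j (yvar q)" and ?b' = "\<delta> j (zvar q)"
  let ?c = "\<delta> k (yvar r)" and ?c' = "\<delta> k (zvar r)"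
  let ?P = "H (\<lambda>m. ?a m + ?b m + ?c m) (\<lambda>m. ?a' m + ?b' m + ?c' m)
      - H (\<lambda>m. ?a m + ?b m) (\<lambda>m. ?a' m + ?b' m) - H (\<lambda>m. ?a m + ?c m) (\<lambda>m. ?a' m + ?c' m)
      - H (\<lambda>m. ?b m + ?c m) (\<lambda>m. ?b' m + ?c' m) + H ?a ?a' + H ?b ?b' + H ?c ?c'"
  have "?P \<in> V"
    using H[of "\<lambda>m. \<gamma> i p m + \<gamma> j q m + \<gamma> k r m", OF G_carrier_closed(1)[OF G_carrier_closed(1)[OF \<gamma>s(1,2)] \<gamma>s(3)]]
      H[of "\<lambda>m. \<gamma> i p m + \<gamma> j q m", OF G_carrier_closed(1)[OF \<gamma>s(1,2)]]
      H[of "\<lambda>m. \<gamma> i p m + \<gamma> k r m", OF G_carrier_closed(1)[OF \<gamma>s(1,3)]]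
      H[of "\<lambda>m. \<gamma> j q m + \<gamma> k r m", OF G_carrier_closed(1)[OF \<gamma>s(2,3)]]
      H[of "\<gamma> i p", OF \<gamma>s(1)] H[of "\<gamma> j q", OF \<gamma>s(2)] H[of "\<gamma> k r", OF \<gamma>s(3)]
    unfolding left_poly_simps right_poly_simps lr by (intro V_add V_diff)
  also have "?P = F A ?a ?b ?c' + F A ?b ?a ?c' + F A ?a ?c ?b' + F A ?c ?a ?b' + F A ?b ?c ?a' + F A ?c ?b ?a'
      + F B ?a ?b' ?c' + F B ?a ?c' ?b' + F B ?b ?a' ?c' + F B ?b ?c' ?a' + F B ?c ?a' ?b' + F B ?c ?b' ?a'"
    unfolding H_def F_def by (simp add: algebra_simps sum.distrib)
  also have "\<dots> = Poly_Mapping.single 0 (A i j k + A j i k) * (yvar p * yvar q * zvar r)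
    + Poly_Mapping.single 0 (A i k j + A k i j) * (yvar p * yvar r * zvar q)
    + Poly_Mapping.single 0 (A j k i + A k j i) * (yvar q * yvar r * zvar p)
    + Poly_Mapping.single 0 (B i j k + B i k j) * (yvar p * zvar q * zvar r)
    + Poly_Mapping.single 0 (B j i k + B j k i) * (yvar q * zvar p * zvar r)
    + Poly_Mapping.single 0 (B k i j + B k j i) * (yvar r * zvar p * zvar q)"
    unfolding F_def \<delta>_def
    by (simp only: sum3_delta[OF finite_atLeastAtMost ijk] sum3_delta[OF finite_atLeastAtMost ijk(1,3,2)]
        sum3_delta[OF finite_atLeastAtMost ijk(2,1,3)] sum3_delta[OF finite_atLeastAtMost ijk(2,3,1)]
        sum3_delta[OF finite_atLeastAtMost ijk(3,1,2)] sum3_delta[OF finite_atLeastAtMost ijk(3,2,1)])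
      (simp add: single_add algebra_simps)
  finally show ?thesis .
qed

text \<open>For a generator and \<open>m = y_q z_r\<close>, polarisation in both orders gives a
  linear system in \<open>y_p m\<close> and \<open>m z_p\<close> with determinant
  \<open>a * a - b * b\<close>. If it vanishes, then \<open>b = a\<close> or \<open>b = - a\<close>,
  and \<open>y_p z_q\<close> is antisymmetric respectively symmetric modulo
  \<open>V\<close>.\<close>

lemma degree_2_consequences:
  assumes "quadratic_form d A \<in> V" "i \<in> {1..d}" "j \<in> {1..d}" "A i j \<noteq> 0"
  shows "G_comp d 3 \<subseteq> J"
proof -
  let ?C = "\<lambda>c. Poly_Mapping.single 0 c :: 'k yzpoly"
  define a b where "a = A i j" and "b = A j i"
  have pol: "?C a * (left_poly g * right_poly h) + ?C b * (left_poly h * right_poly g) \<in> V"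
    if "g \<in> G_carrier d" "h \<in> G_carrier d" for g h
    using quadratic_polarisation[OF assms(1-3) that] by (simp add: a_def b_def)
  have lin: "?C a * (yvar p * zvar q) + ?C b * (yvar q * zvar p) \<in> V"
    if "p \<in> {1..d}" "q \<in> {1..d}" for p q
    using pol[OF that[THEN gen_in_G_carrier]] by simp
  have yzq: "?C a * (yvar p * (yvar q * zvar r)) + ?C b * (yvar q * zvar r * zvar p) \<in> V"
       "?C a * (yvar q * zvar r * zvar p) + ?C b * (yvar p * (yvar q * zvar r)) \<in> V"
    if "p \<in> {1..d}" "q \<in> {1..d}" "r \<in> {1..d}" for p q r
    using pol[OF gen_in_G_carrier[OF that(1)] yz_in_G_carrier[OF that(2,3)]]
      pol[OF yz_in_G_carrier[OF that(2,3)] gen_in_G_carrier[OF that(1)]] by simp_all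
  have C_mult: "?C (x * y) = ?C x * ?C y" for x y
    by (simp add: mult_single)
  note C_simps = single_diff C_mult algebra_simps
  have a: "a \<noteq> 0" using assms(4) by (simp add: a_def)
  consider "a * a \<noteq> b * b" | "b = a" | "b = - a"
    by (metis square_eq_iff)
  then show ?thesis
  proof cases
    case 1
    have "yvar p * yvar q * zvar r \<in> V" "yvar q * zvar r * zvar p \<in> V"
      if I: "p \<in> {1..d}" "q \<in> {1..d}" "r \<in> {1..d}" for p q r
    proof -
      have "?C (a * a - b * b) * (yvar p * yvar q * zvar r) \<in> V"
        using V_diff[OF V_const[OF yzq(1)[OF I], of a] V_const[OF yzq(2)[OF I], of b]]
        by (simp add: C_simps)
      then show "yvar p * yvar q * zvar r \<in> V" by (rule V_const_cancel) (use 1 in simp)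
      have "?C (a * a - b * b) * (yvar q * zvar r * zvar p) \<in> V"
        using V_diff[OF V_const[OF yzq(2)[OF I], of a] V_const[OF yzq(1)[OF I], of b]]
        by (simp add: C_simps)
      then show "yvar q * zvar r * zvar p \<in> V" by (rule V_const_cancel) (use 1 in simp)
    qed
    then show ?thesis by (intro G_comp_3_subset_J)
  next
    case 2
    have s: "yvar p * zvar q + yvar q * zvar p \<in> V" if "p \<in> {1..d}" "q \<in> {1..d}" for p q
      using lin[OF that] a unfolding 2 by - (rule V_const_cancel[of a]; simp add: algebra_simps)
    have yz: "yvar p * (yvar q * zvar r) + yvar q * zvar r * zvar p \<in> V"
      if "p \<in> {1..d}" "q \<in> {1..d}" "r \<in> {1..d}" for p q r
      using yzq(1)[OF that] a unfolding 2 by - (rule V_const_cancel[of a]; simp add: algebra_simps)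
    have yyz: "yvar p * yvar q * zvar r \<in> V"
      if I: "p \<in> {1..d}" "q \<in> {1..d}" "r \<in> {1..d}" for p q r
    proof -
      \<comment> \<open>Antisymmetry is applied to the three pairs; with these signs all terms
        except \<open>y_p y_q z_r\<close> cancel.\<close>
      have "yvar p * (yvar q * zvar r + yvar r * zvar q) + yvar q * (yvar p * zvar r + yvar r * zvar p)
          - yvar r * (yvar p * zvar q + yvar q * zvar p) \<in> V"
        using I by (intro V_diff[OF V_add] V_yvar s)
      also have "yvar p * (yvar q * zvar r + yvar r * zvar q) + yvar q * (yvar p * zvar r + yvar r * zvar p)
          - yvar r * (yvar p * zvar q + yvar q * zvar p) = 2 * (yvar p * yvar q * zvar r :: 'k yzpoly)"
        by (simp add: algebra_simps)
      finally show ?thesis by (rule V_numeral_cancel)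
    qed
    have "yvar q * zvar r * zvar p \<in> V" if I: "p \<in> {1..d}" "q \<in> {1..d}" "r \<in> {1..d}" for p q r
      using V_diff[OF yz[OF I] yyz[OF I]] by (simp add: algebra_simps)
    with yyz show ?thesis by (intro G_comp_3_subset_J)
  next
    case 3
    have s: "yvar p * zvar q - yvar q * zvar p \<in> V" if "p \<in> {1..d}" "q \<in> {1..d}" for p q
      using lin[OF that] a unfolding 3 by - (rule V_const_cancel[of a]; simp add: algebra_simps single_uminus)
    have yz: "yvar p * (yvar q * zvar r) - yvar q * zvar r * zvar p \<in> V"
      if "p \<in> {1..d}" "q \<in> {1..d}" "r \<in> {1..d}" for p q r
      using yzq(1)[OF that] a unfolding 3 by - (rule V_const_cancel[of a]; simp add: algebra_simps single_uminus)
    have yyz: "yvar p * yvar q * zvar r \<in> V"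
      if I: "p \<in> {1..d}" "q \<in> {1..d}" "r \<in> {1..d}" for p q r
    proof -
      define E :: "'k yzpoly" where "E = yvar p * yvar q * zvar r + yvar p * yvar r * zvar q + yvar q * yvar r * zvar p
        + yvar p * zvar q * zvar r + yvar q * zvar p * zvar r + yvar r * zvar p * zvar q"
      have E: "E \<in> V" using cubic_identity[OF I] by (simp add: E_def)
      \<comment> \<open>Replacing a \<open>z\<close> by a \<open>y\<close> in the last three terms
        of \<open>E\<close> leaves the three \<open>y y z\<close> monomials with coefficients 1, 2
        and 3; symmetry merges them into six copies of \<open>y_p y_q z_r\<close>.\<close>
      have "E + (yvar r * (yvar p * zvar q) - yvar p * zvar q * zvar r)
          + (yvar r * (yvar q * zvar p) - yvar q * zvar p * zvar r)
          + (yvar q * (yvar r * zvar p) - yvar r * zvar p * zvar q)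
          + 2 * (yvar p * (yvar q * zvar r - yvar r * zvar q))
          + 3 * (yvar q * (yvar p * zvar r - yvar r * zvar p)) \<in> V"
        using I E by (intro V_add[OF V_add[OF V_add[OF V_add[OF V_add]]]] V_numeral V_yvar yz s)
      then have "6 * (yvar p * yvar q * zvar r) \<in> V"
        by (simp add: E_def algebra_simps)
      then show ?thesis by (rule V_numeral_cancel)
    qed
    have "yvar q * zvar r * zvar p \<in> V" if I: "p \<in> {1..d}" "q \<in> {1..d}" "r \<in> {1..d}" for p q r
      using V_diff[OF yyz[OF I] yz[OF I]] by (simp add: algebra_simps)
    with yyz show ?thesis by (intro G_comp_3_subset_J)
  qed
qed

text \<open>Exchanging \<open>p\<close> and \<open>l\<close> leaves the second and third terms
  unchanged, so the difference shows that the place of the single \<open>z\<close> is irrelevant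
  modulo \<open>V\<close>. Then \<open>degree_4_sum\<close> is four times one monomial.\<close>

lemma degree_4_from_relation:
  assumes rel: "\<And>p q r l. p \<in> {1..d} \<Longrightarrow> q \<in> {1..d} \<Longrightarrow> r \<in> {1..d} \<Longrightarrow> l \<in> {1..d} \<Longrightarrow>
      Poly_Mapping.single 0 c1 * (yvar q * yvar r * yvar l * zvar p)
      + Poly_Mapping.single 0 c2 * (yvar p * yvar r * yvar l * zvar q)
      + Poly_Mapping.single 0 c3 * (yvar p * yvar q * yvar l * zvar r) \<in> V"
    and c1: "c1 \<noteq> 0"
  shows "G_comp d 4 \<subseteq> J"
proof -
  have D: "yvar q * yvar r * yvar l * zvar p - yvar q * yvar r * yvar p * zvar l \<in> V"
    if I: "p \<in> {1..d}" "q \<in> {1..d}" "r \<in> {1..d}" "l \<in> {1..d}" for p q r l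
  proof (rule V_const_cancel[OF _ c1])
    show "Poly_Mapping.single 0 c1 * (yvar q * yvar r * yvar l * zvar p - yvar q * yvar r * yvar p * zvar l) \<in> V"
      using V_diff[OF rel[OF I] rel[OF I(4,2,3,1)]] by (simp add: algebra_simps)
  qed
  have "yvar i * yvar j * yvar k * zvar l \<in> V"
    if I: "i \<in> {1..d}" "j \<in> {1..d}" "k \<in> {1..d}" "l \<in> {1..d}" for i j k l
  proof (rule V_numeral_cancel)
    show "4 * (yvar i * yvar j * yvar k * zvar l) \<in> V"
      using V_diff[OF V_diff[OF V_diff[OF degree_4_sum[OF I] D[OF I(1,2,3,4)]] D[OF I(2,1,3,4)]] D[OF I(3,1,2,4)]]
      by (simp add: algebra_simps)
  qed
  then show ?thesis by (rule G_comp_4_subset_J)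
qed

text \<open>The index of \<open>a1\<close>, \<open>a2\<close>, \<open>a3\<close> is the position in
  \<open>(p, q, r)\<close> of the \<open>z\<close> variable, that of \<open>b1\<close>,
  \<open>b2\<close>, \<open>b3\<close> the position of the \<open>y\<close> variable. The two
  alternatives in \<open>ne\<close> correspond to multiplication by \<open>y_l\<close> and by
  \<open>z_l\<close>.\<close>

lemma degree_3_consequences:
  assumes rel: "\<And>p q r. p \<in> {1..d} \<Longrightarrow> q \<in> {1..d} \<Longrightarrow> r \<in> {1..d} \<Longrightarrow>
      Poly_Mapping.single 0 a3 * (yvar p * yvar q * zvar r)
    + Poly_Mapping.single 0 a2 * (yvar p * yvar r * zvar q)
    + Poly_Mapping.single 0 a1 * (yvar q * yvar r * zvar p)
    + Poly_Mapping.single 0 b1 * (yvar p * zvar q * zvar r)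
    + Poly_Mapping.single 0 b2 * (yvar q * zvar p * zvar r)
    + Poly_Mapping.single 0 b3 * (yvar r * zvar p * zvar q) \<in> V"
    and ne: "2 * a1 \<noteq> b2 + b3 \<or> 2 * b1 \<noteq> a2 + a3"
  shows "G_comp d 4 \<subseteq> J"
proof -
  let ?C = "\<lambda>c. Poly_Mapping.single 0 c :: 'k yzpoly"
  define R where "R = (\<lambda>p q r. ?C a3 * (yvar p * yvar q * zvar r) + ?C a2 * (yvar p * yvar r * zvar q)
    + ?C a1 * (yvar q * yvar r * zvar p) + ?C b1 * (yvar p * zvar q * zvar r)
    + ?C b2 * (yvar q * zvar p * zvar r) + ?C b3 * (yvar r * zvar p * zvar q))"
  define S where "S = (\<lambda>i j k l. yvar j * yvar k * yvar l * zvar i + yvar i * yvar k * yvar l * zvar j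
      + yvar i * yvar j * yvar l * zvar k + yvar i * yvar j * yvar k * (zvar l :: 'k yzpoly))"
  define M where "M = (\<lambda>i j k l. 2 * (yvar i * yvar j * zvar k * zvar l)
      - yvar j * yvar k * yvar l * zvar i - yvar i * yvar k * yvar l * (zvar j :: 'k yzpoly))"
  define N where "N = (\<lambda>i j k l. yvar i * zvar j * zvar k * zvar l + yvar j * yvar k * yvar l * (zvar i :: 'k yzpoly))"
  have R: "R p q r \<in> V" if "p \<in> {1..d}" "q \<in> {1..d}" "r \<in> {1..d}" for p q r
    using rel[OF that] by (simp add: R_def)
  have SMN: "S i j k l \<in> V" "M i j k l \<in> V" "N i j k l \<in> V"
    if "i \<in> {1..d}" "j \<in> {1..d}" "k \<in> {1..d}" "l \<in> {1..d}" for i j k l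
    using degree_4_relations[OF that] by (simp_all add: S_def M_def N_def)
  have C2: "?C (2 * c) = 2 * ?C c" "?C (c * 2) = 2 * ?C c" for c
    by (simp_all only: mult_2 mult_2_right single_add)
  note C_simps = single_diff single_add C2 algebra_simps
  from ne consider "2 * a1 - b2 - b3 \<noteq> 0" | "a2 + a3 - 2 * b1 \<noteq> 0"
    by (metis add.commute diff_add_cancel diff_diff_eq eq_iff_diff_eq_0)
  then show ?thesis
  proof cases
    case 1
    show ?thesis
    proof (rule degree_4_from_relation[OF _ 1])
      fix p q r l assume I: "p \<in> {1..d}" "q \<in> {1..d}" "r \<in> {1..d}" "l \<in> {1..d}"
      \<comment> \<open>The \<open>M\<close> terms reduce the \<open>y y z z\<close> monomials; this
        creates \<open>b1 + b2 + b3\<close> copies of \<open>y_p y_q y_r z_l\<close>, which the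
        multiple of \<open>S\<close> removes.\<close>
      have "2 * (yvar l * R p q r) - ?C b1 * M p l q r - ?C b2 * M q l p r - ?C b3 * M r l p q
          - ?C (b1 + b2 + b3) * S p q r l \<in> V"
        using I by (intro V_diff V_numeral V_yvar V_const R SMN)
      then show "?C (2 * a1 - b2 - b3) * (yvar q * yvar r * yvar l * zvar p)
        + ?C (2 * a2 - b1 - b3) * (yvar p * yvar r * yvar l * zvar q)
        + ?C (2 * a3 - b1 - b2) * (yvar p * yvar q * yvar l * zvar r) \<in> V"
        unfolding R_def S_def M_def by (simp add: C_simps)
    qed
  next
    case 2
    show ?thesis
    proof (rule degree_4_from_relation[OF _ 2])
      fix p q r l assume I: "p \<in> {1..d}" "q \<in> {1..d}" "r \<in> {1..d}" "l \<in> {1..d}"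
      \<comment> \<open>Here \<open>M\<close> reduces the \<open>y y z z\<close> monomials and
        \<open>N\<close> the \<open>y z z z\<close> ones, and no term with the single
        \<open>z\<close> equal to \<open>z_l\<close> arises.\<close>
      have "2 * (zvar l * R p q r) - ?C a3 * M p q r l - ?C a2 * M p r q l - ?C a1 * M q r p l
          - ?C (2 * b1) * N p q r l - ?C (2 * b2) * N q p r l - ?C (2 * b3) * N r p q l \<in> V"
        using I by (intro V_diff V_numeral V_zvar V_const R SMN)
      then show "?C (a2 + a3 - 2 * b1) * (yvar q * yvar r * yvar l * zvar p)
        + ?C (a1 + a3 - 2 * b2) * (yvar p * yvar r * yvar l * zvar q)
        + ?C (a1 + a2 - 2 * b3) * (yvar p * yvar q * yvar l * zvar r) \<in> V"
        unfolding R_def N_def M_def by (simp add: C_simps)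
    qed
  qed
qed

text \<open>If the conclusion fails, \<open>degree_3_consequences\<close> yields linear equations
  for every ordering of the triple, and these force all six coefficients to agree, contrary to the
  last assumption.\<close>

lemma cubic_form_consequences:
  assumes "cubic_form d A B \<in> V"
    and "i \<in> {1..d}" "j \<in> {1..d}" "k \<in> {1..d}"
    and "A i j k + A j i k \<noteq> B i j k + B i k j \<or> A i j k + A j i k \<noteq> A i k j + A k i j"
  shows "G_comp d 4 \<subseteq> J"
proof (rule ccontr)
  assume not: "\<not> ?thesis"
  note pol = cubic_polarisation[OF assms(1)]
  define a b where "a = (\<lambda>i j k. A i j k + A j i k)" and "b = (\<lambda>i j k. B i j k + B i k j)"
  have eq: "2 * a j k i = b j i k + b k i j \<and> 2 * b i j k = a i k j + a i j k"
    if I: "i \<in> {1..d}" "j \<in> {1..d}" "k \<in> {1..d}" for i j k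
    using degree_3_consequences[OF pol[OF I]] not unfolding a_def b_def by (metis add.commute)
  have sym: "a i j k = a j i k" "b i j k = b i k j" for i j k
    by (simp_all add: a_def b_def add.commute)
  note I = assms(2-4)
  define a1 a2 a3 b1 b2 b3 where "a1 = a j k i" and "a2 = a i k j" and "a3 = a i j k"
    and "b1 = b i j k" and "b2 = b j i k" and "b3 = b k i j"
  have e: "2 * a1 = b2 + b3" "2 * b1 = a2 + a3" "2 * a2 = b1 + b3" "2 * b2 = a1 + a3"
    "2 * a3 = b1 + b2" "2 * b3 = a1 + a2"
    using eq[OF I] eq[OF I(2,1,3)] eq[OF I(3,1,2)] sym
    by (simp_all add: a1_def a2_def a3_def b1_def b2_def b3_def add.commute)
  \<comment> \<open>Applying the equations twice gives \<open>4 * (a1 - a2) = a1 - a2\<close>, hence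
    equality in characteristic 0.\<close>
  have "4 * (a1 - a2) = 2 * (2 * a1) - 2 * (2 * a2)" by (simp add: algebra_simps)
  also have "\<dots> = 2 * b2 - 2 * b1" unfolding e(1,3) by (simp add: algebra_simps)
  also have "\<dots> = a1 - a2" unfolding e(2,4) by simp
  finally have 1: "a1 = a2" by simp
  have "4 * (a3 - a2) = 2 * (2 * a3) - 2 * (2 * a2)" by (simp add: algebra_simps)
  also have "\<dots> = 2 * b2 - 2 * b3" unfolding e(3,5) by (simp add: algebra_simps)
  also have "\<dots> = a3 - a2" unfolding e(4,6) by simp
  finally have 2: "a3 = a2" by simp
  have "2 * b1 = 2 * a3" using e(2) 2 by simp
  then have "b1 = a3" by simp
  with 2 assms(5) show False
    by (auto simp: a2_def a3_def b1_def a_def b_def)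
qed

text \<open>Complement of the preceding lemma: when the six coefficients agree for every triple, six
  times the form is the sum of the cubic identities weighted by these coefficients. A cubic form
  outside \<open>V\<close> thus has a triple on which they differ.\<close>

lemma symmetric_cubic_form_in_V:
  assumes AB: "\<And>i j k. i \<in> {1..d} \<Longrightarrow> j \<in> {1..d} \<Longrightarrow> k \<in> {1..d} \<Longrightarrow> A i j k + A j i k = B i j k + B i k j"
    and AA: "\<And>i j k. i \<in> {1..d} \<Longrightarrow> j \<in> {1..d} \<Longrightarrow> k \<in> {1..d} \<Longrightarrow> A i j k + A j i k = A i k j + A k i j"
  shows "cubic_form d A B \<in> V"
proof -
  define S where "S = (\<lambda>f. \<Sum>i\<in>{1..d}. \<Sum>j\<in>{1..d}. \<Sum>k\<in>{1..d}. f i j k :: 'k yzpoly)"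
  define a where "a = (\<lambda>i j k. A i j k + A j i k)"
  let ?C = "\<lambda>c. Poly_Mapping.single 0 c :: 'k yzpoly"
  have S_cong: "S f = S g"
    if "\<And>i j k. i \<in> {1..d} \<Longrightarrow> j \<in> {1..d} \<Longrightarrow> k \<in> {1..d} \<Longrightarrow> f i j k = g i j k" for f g
    unfolding S_def by (intro sum.cong refl that)
  have swap12: "S f = S (\<lambda>i j k. f j i k)" for f
    unfolding S_def by (rule sum.swap)
  have swap23: "S f = S (\<lambda>i j k. f i k j)" for f
    unfolding S_def by (intro sum.cong refl sum.swap)
  have S_add: "S (\<lambda>i j k. f i j k + g i j k) = S f + S g" for f g
    unfolding S_def by (simp add: sum.distrib)
  have a12: "a i j k = a j i k" for i j k
    by (simp add: a_def add.commute)
  have a23: "a i j k = a i k j" if "i \<in> {1..d}" "j \<in> {1..d}" "k \<in> {1..d}" for i j k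
    using AA[OF that] by (simp add: a_def)
  define Y where "Y = S (\<lambda>i j k. ?C (a i j k) * (yvar i * yvar j * zvar k))"
  define Z where "Z = S (\<lambda>i j k. ?C (a i j k) * (yvar i * zvar j * zvar k))"
  have Y2: "S (\<lambda>i j k. ?C (a i j k) * (yvar i * yvar k * zvar j)) = Y"
    unfolding Y_def by (subst swap23) (intro S_cong, simp add: a23)
  have Y3: "S (\<lambda>i j k. ?C (a i j k) * (yvar j * yvar k * zvar i)) = Y"
    unfolding Y2[symmetric] by (subst swap12) (intro S_cong, simp add: a12)
  have Z2: "S (\<lambda>i j k. ?C (a i j k) * (yvar j * zvar i * zvar k)) = Z"
    unfolding Z_def by (subst swap12) (intro S_cong, simp add: a12)
  have Z3: "S (\<lambda>i j k. ?C (a i j k) * (yvar k * zvar i * zvar j)) = Z"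
    unfolding Z2[symmetric] by (subst swap23) (intro S_cong, simp add: a23)
  have "S (\<lambda>i j k. ?C (a i j k) * (yvar i * yvar j * zvar k + yvar i * yvar k * zvar j + yvar j * yvar k * zvar i
    + yvar i * zvar j * zvar k + yvar j * zvar i * zvar k + yvar k * zvar i * zvar j)) \<in> V"
    unfolding S_def by (intro V_sum V_const cubic_identity)
  also have "S (\<lambda>i j k. ?C (a i j k) * (yvar i * yvar j * zvar k + yvar i * yvar k * zvar j + yvar j * yvar k * zvar i
    + yvar i * zvar j * zvar k + yvar j * zvar i * zvar k + yvar k * zvar i * zvar j)) = 3 * (Y + Z)"
    unfolding distrib_left S_add Y2 Y3 Z2 Z3 by (simp flip: Y_def Z_def)
  finally have YZ: "Y + Z \<in> V" by (rule V_numeral_cancel)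
  define YA where "YA = S (\<lambda>i j k. ?C (A i j k) * (yvar i * yvar j * zvar k))"
  define ZB where "ZB = S (\<lambda>i j k. ?C (B i j k) * (yvar i * zvar j * zvar k))"
  have "S (\<lambda>i j k. ?C (A j i k) * (yvar i * yvar j * zvar k)) = YA"
    unfolding YA_def by (subst swap12) (simp add: mult_ac)
  then have "Y = 2 * YA"
    unfolding Y_def a_def single_add distrib_right S_add by (simp flip: YA_def)
  moreover have "S (\<lambda>i j k. ?C (B i k j) * (yvar i * zvar j * zvar k)) = ZB"
    unfolding ZB_def by (subst swap23) (simp add: mult_ac)
  then have "S (\<lambda>i j k. ?C (B i j k + B i k j) * (yvar i * zvar j * zvar k)) = 2 * ZB"
    unfolding single_add distrib_right S_add by (simp flip: ZB_def)
  moreover have "Z = S (\<lambda>i j k. ?C (B i j k + B i k j) * (yvar i * zvar j * zvar k))"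
    unfolding Z_def by (intro S_cong) (simp add: a_def AB)
  moreover have "cubic_form d A B = YA + ZB"
    unfolding cubic_form_def YA_def ZB_def S_add[symmetric] by (simp add: S_def)
  ultimately have "2 * cubic_form d A B \<in> V"
    using YZ by (simp add: algebra_simps)
  then show ?thesis by (rule V_numeral_cancel)
qed

end

subsection \<open>The quotient algebra\<close>

lemma scale_minus_one: "scale (- 1) f = - f"
  by (rule poly_mapping_eqI) simp

lemma G_mult_distrib:
  "G_mult (f + u) (g + v) = G_mult f g + (G_mult f v + G_mult u g + G_mult u v)"
  by (simp add: G_mult_eq algebra_simps)

text \<open>The operations of \<open>na_quot\<close> are unions over representatives; they are
  single cosets once the result is independent of the representatives.\<close>

lemma UN_const_on: "X \<noteq> {} \<Longrightarrow> (\<And>x. x \<in> X \<Longrightarrow> F x = c) \<Longrightarrow> (\<Union>x\<in>X. F x) = c"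
  by auto

locale G_T_ideal =
  fixes d :: nat and I :: "(gbasis \<Rightarrow>\<^sub>0 'k::field) set"
  assumes T_ideal_I: "T_ideal (G_alg d) I"
begin

abbreviation coset :: "(gbasis \<Rightarrow>\<^sub>0 'k) \<Rightarrow> (gbasis \<Rightarrow>\<^sub>0 'k) set" where
  "coset \<equiv> na_coset (G_alg d) I"

abbreviation Q :: "('k, (gbasis \<Rightarrow>\<^sub>0 'k) set) nalg" where
  "Q \<equiv> na_quot (G_alg d) I"

lemma I_closed:
  "I \<subseteq> G_carrier d" "0 \<in> I" "u \<in> I \<Longrightarrow> v \<in> I \<Longrightarrow> u + v \<in> I" "u \<in> I \<Longrightarrow> scale c u \<in> I"
  "u \<in> I \<Longrightarrow> f \<in> G_carrier d \<Longrightarrow> G_mult f u \<in> I"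
  "u \<in> I \<Longrightarrow> f \<in> G_carrier d \<Longrightarrow> G_mult u f \<in> I"
  "na_endo (G_alg d) \<phi> \<Longrightarrow> u \<in> I \<Longrightarrow> \<phi> u \<in> I"
  using T_ideal_I unfolding T_ideal_def na_ideal_def by (auto simp: image_subset_iff)

lemma coset_shift:
  assumes "u \<in> I"
  shows "coset (f + u) = coset f"
proof -
  have "f + u + v \<in> (+) f ` I" "f + v \<in> (+) (f + u) ` I" if "v \<in> I" for v
  proof -
    show "f + u + v \<in> (+) f ` I"
      using I_closed(3)[OF assms that] by (auto simp: add.assoc)
    have "v - u \<in> I"
      using I_closed(3)[OF that I_closed(4)[OF assms, of "- 1"]] by (simp add: scale_minus_one)
    then show "f + v \<in> (+) (f + u) ` I" by (intro image_eqI[of _ _ "v - u"]) simp_all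
  qed
  then show ?thesis by (auto simp: na_coset_def)
qed

lemma coset_eqI: "u \<in> I \<Longrightarrow> g = f + u \<Longrightarrow> coset g = coset f"
  using coset_shift by simp

lemma in_cosetD: "g \<in> coset f \<Longrightarrow> \<exists>u\<in>I. g = f + u"
  by (auto simp: na_coset_def)

lemma coset_nonempty: "coset f \<noteq> {}"
  using I_closed(2) by (auto simp: na_coset_def)

lemma Q_simps:
  "na_carrier Q = coset ` G_carrier d" "na_zero Q = coset 0"
  "na_add Q (coset f) (coset g) = coset (f + g)"
  "na_smult Q c (coset f) = coset (scale c f)"
proof -
  show "na_add Q (coset f) (coset g) = coset (f + g)"
    unfolding na_quot_def nalg.simps G_alg_simps
  proof (intro UN_const_on coset_nonempty)
    fix f' g' assume "f' \<in> coset f" "g' \<in> coset g"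
    then obtain u v where uv: "u \<in> I" "v \<in> I" "f' = f + u" "g' = g + v" using in_cosetD by meson
    show "coset (f' + g') = coset (f + g)"
      by (rule coset_eqI[OF I_closed(3)[OF uv(1,2)]]) (simp add: uv algebra_simps)
  qed
  show "na_smult Q c (coset f) = coset (scale c f)"
    unfolding na_quot_def nalg.simps G_alg_simps
  proof (intro UN_const_on coset_nonempty)
    fix f' assume "f' \<in> coset f"
    then obtain u where u: "u \<in> I" "f' = f + u" using in_cosetD by meson
    show "coset (scale c f') = coset (scale c f)"
      by (rule coset_eqI[OF I_closed(4)[OF u(1)]]) (simp add: u scale_add)
  qed
qed (simp_all add: na_quot_def)

lemma Q_mult:
  assumes "f \<in> G_carrier d" "g \<in> G_carrier d"
  shows "na_mult Q (coset f) (coset g) = coset (G_mult f g)"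
  unfolding na_quot_def nalg.simps G_alg_simps
proof (intro UN_const_on coset_nonempty)
  fix f' g' assume "f' \<in> coset f" "g' \<in> coset g"
  then obtain u v where uv: "u \<in> I" "v \<in> I" "f' = f + u" "g' = g + v" using in_cosetD by meson
  have "G_mult f v + G_mult u g + G_mult u v \<in> I"
    using I_closed(5)[OF uv(2) assms(1)] I_closed(6)[OF uv(1) assms(2)]
      I_closed(5)[OF uv(2) subsetD[OF I_closed(1) uv(1)]] by (intro I_closed(3))
  then show "coset (G_mult f' g') = coset (G_mult f g)"
    by (rule coset_eqI) (simp add: uv G_mult_distrib)
qed

lemma induced_endo:
  assumes "na_endo (G_alg d) \<phi>"
  obtains \<psi> where "na_endo Q \<psi>" "\<And>f. f \<in> G_carrier d \<Longrightarrow> \<psi> (coset f) = coset (\<phi> f)"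
proof
  have \<phi>: "\<And>f. f \<in> G_carrier d \<Longrightarrow> \<phi> f \<in> G_carrier d"
    "\<And>f g. f \<in> G_carrier d \<Longrightarrow> g \<in> G_carrier d \<Longrightarrow> \<phi> (f + g) = \<phi> f + \<phi> g"
    "\<And>c f. f \<in> G_carrier d \<Longrightarrow> \<phi> (scale c f) = scale c (\<phi> f)"
    "\<And>f g. f \<in> G_carrier d \<Longrightarrow> g \<in> G_carrier d \<Longrightarrow> \<phi> (G_mult f g) = G_mult (\<phi> f) (\<phi> g)"
    using assms unfolding na_endo_def G_alg_simps by blast+
  define \<psi> where "\<psi> = (\<lambda>X. \<Union>f\<in>X. coset (\<phi> f))"
  show \<psi>: "\<psi> (coset f) = coset (\<phi> f)" if "f \<in> G_carrier d" for f
    unfolding \<psi>_def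
  proof (intro UN_const_on coset_nonempty)
    fix f' assume "f' \<in> coset f"
    then obtain u where u: "u \<in> I" "f' = f + u" using in_cosetD by meson
    show "coset (\<phi> f') = coset (\<phi> f)"
      using I_closed(7)[OF assms u(1)]
      by (rule coset_eqI) (use \<phi>(2)[OF that subsetD[OF I_closed(1) u(1)]] u in simp)
  qed
  show "na_endo Q \<psi>"
    unfolding na_endo_def Q_simps(1) ball_simps(9)
    by (intro conjI ballI allI)
      (simp_all only: Q_simps(3,4) Q_mult \<psi> \<phi> G_carrier_closed G_mult_in_G_carrier imageI)
qed

text \<open>Transfers T-ideals of the quotient to the original algebra. Only endomorphisms of
  \<open>G_alg d\<close> have to be checked, and these descend by
  \<open>induced_endo\<close>.\<close>

lemma T_ideal_preimage:
  assumes "T_ideal Q K"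
  shows "T_ideal (G_alg d) {g \<in> G_carrier d. coset g \<in> K}" "I \<subseteq> {g \<in> G_carrier d. coset g \<in> K}"
proof -
  have K: "na_zero Q \<in> K" "\<And>X Y. X \<in> K \<Longrightarrow> Y \<in> K \<Longrightarrow> na_add Q X Y \<in> K"
    "\<And>c X. X \<in> K \<Longrightarrow> na_smult Q c X \<in> K"
    "\<And>X Y. X \<in> K \<Longrightarrow> Y \<in> na_carrier Q \<Longrightarrow> na_mult Q Y X \<in> K"
    "\<And>X Y. X \<in> K \<Longrightarrow> Y \<in> na_carrier Q \<Longrightarrow> na_mult Q X Y \<in> K"
    "\<And>\<psi> X. na_endo Q \<psi> \<Longrightarrow> X \<in> K \<Longrightarrow> \<psi> X \<in> K"
    using assms unfolding T_ideal_def na_ideal_def by (auto simp: image_subset_iff)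
  let ?J = "{g \<in> G_carrier d. coset g \<in> K}"
  have J: "g \<in> ?J \<longleftrightarrow> g \<in> G_carrier d \<and> coset g \<in> K" for g by simp
  show "I \<subseteq> ?J"
    using I_closed(1) K(1) coset_shift[of _ 0] by (auto simp: Q_simps)
  have "na_ideal (G_alg d) ?J"
    unfolding na_ideal_def G_alg_simps J
  proof (intro conjI ballI allI)
    show "?J \<subseteq> G_carrier d" "0 \<in> G_carrier d" "coset 0 \<in> K" using K(1) by (auto simp: Q_simps)
    fix u assume u: "u \<in> ?J"
    show "scale c u \<in> G_carrier d" "coset (scale c u) \<in> K" for c
      using G_carrier_closed(2)[of u d c] K(3)[of "coset u" c] u unfolding J Q_simps by blast+
    fix f :: "gbasis \<Rightarrow>\<^sub>0 'k" assume f: "f \<in> G_carrier d"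
    show "G_mult f u \<in> G_carrier d" "G_mult u f \<in> G_carrier d"
      using G_mult_in_G_carrier f u unfolding J by blast+
    have "coset f \<in> na_carrier Q" using f by (simp add: Q_simps)
    then show "coset (G_mult f u) \<in> K" "coset (G_mult u f) \<in> K"
      using K(4,5)[of "coset u" "coset f"] u f Q_mult unfolding J by metis+
  next
    fix u v assume "u \<in> ?J" "v \<in> ?J"
    then show "u + v \<in> G_carrier d" "coset (u + v) \<in> K"
      using G_carrier_closed(1)[of u d v] K(2)[of "coset u" "coset v"] unfolding J Q_simps by blast+
  qed
  moreover have "\<phi> g \<in> ?J" if \<phi>: "na_endo (G_alg d) \<phi>" and g: "g \<in> ?J" for \<phi> g
  proof -
    obtain \<psi> where "na_endo Q \<psi>" "\<And>f. f \<in> G_carrier d \<Longrightarrow> \<psi> (coset f) = coset (\<phi> f)"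
      using induced_endo[OF \<phi>] by blast
    then have "coset (\<phi> g) \<in> K" using K(6) g unfolding J by metis
    moreover have "\<phi> g \<in> G_carrier d"
      using \<phi> g unfolding na_endo_def G_alg_simps J by blast
    ultimately show ?thesis unfolding J by blast
  qed
  ultimately show "T_ideal (G_alg d) ?J" unfolding T_ideal_def by blast
qed

end

section \<open>Generated T-ideals and the final assembly\<close>

lemma T_ideal_G_carrier: "T_ideal (G_alg d) (G_carrier d :: (gbasis \<Rightarrow>\<^sub>0 'a::field) set)"
proof -
  have "na_ideal (G_alg d) (G_carrier d :: (gbasis \<Rightarrow>\<^sub>0 'a) set)"
    unfolding na_ideal_def G_alg_simps
    by (intro conjI ballI allI G_carrier_closed G_mult_in_G_carrier; (assumption | simp))
  then show ?thesis by (auto simp: T_ideal_def na_endo_def)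
qed

text \<open>An empty intersection would be the whole type, which need not lie in the carrier; for
  \<open>U_ideal\<close> the carrier itself is a member of the family.\<close>

lemma T_ideal_Inter:
  assumes "F \<noteq> {}" "\<And>I. I \<in> F \<Longrightarrow> T_ideal A I"
  shows "T_ideal A (\<Inter>F)"
  using assms unfolding T_ideal_def na_ideal_def by blast

lemma U_poly_in_G_carrier: "d \<ge> 1 \<Longrightarrow> U_poly \<alpha> \<beta> \<in> G_carrier d"
  unfolding U_poly_def
  by (intro G_carrier_closed(1)) (auto simp: G_basis_def)

lemma U_T_ideal_U_ideal:
  fixes \<alpha> :: "'k::field_char_0"
  assumes "d \<ge> 1" "\<alpha> \<noteq> 0"
  shows "U_T_ideal d \<alpha> (U_ideal d \<alpha> \<alpha>)"
proof
  have "G_carrier d \<in> {I. T_ideal (G_alg d) I \<and> {U_poly \<alpha> \<alpha>} \<subseteq> I}"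
    using T_ideal_G_carrier U_poly_in_G_carrier[OF assms(1), of \<alpha> \<alpha>] by auto
  then show "T_ideal (G_alg d) (U_ideal d \<alpha> \<alpha>)"
    unfolding U_ideal_def T_ideal_generated_def by (intro T_ideal_Inter) auto
  show "U_poly \<alpha> \<alpha> \<in> U_ideal d \<alpha> \<alpha>"
    unfolding U_ideal_def T_ideal_generated_def by auto
qed (rule assms)

text \<open>\<open>U\<close> is the T-ideal modulo which \<open>f\<close> is nonzero,
  \<open>J\<close> one that contains \<open>f\<close>. In degrees 1 and 2 it is enough that
  \<open>f\<close> is not 0; in degree 3, \<open>symmetric_cubic_form_in_V\<close> for
  \<open>U\<close> provides the triple with differing coefficients.\<close>

lemma consequences_of_degree_1_2_3:
  fixes \<alpha> :: "'k::field_char_0"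
  assumes J: "U_T_ideal d \<alpha> J" and U: "U_T_ideal d \<alpha> U"
    and n: "n \<in> {1, 2, 3}" and f: "f \<in> G_comp d n" "f \<in> J" "f \<notin> U"
  shows "G_comp d (n + 1) \<subseteq> J"
proof -
  interpret J: U_T_ideal d \<alpha> J by fact
  interpret U: U_T_ideal d \<alpha> U by fact
  from n consider "n = 1" | "n = 2" | "n = 3" by blast
  then show ?thesis
  proof cases
    case 1
    have "f \<noteq> 0" using f(3) U.J_closed(1) by blast
    then have "G_carrier d \<subseteq> J" using J.degree_1_consequences f 1 by blast
    then show ?thesis by (auto simp: G_comp_def)
  next
    case 2
    obtain A where A: "f = of_yz (quadratic_form d A)"
      using G_comp_2_quadratic_form f(1) 2 by metis
    have "f = 0" if "\<And>i j. i \<in> {1..d} \<Longrightarrow> j \<in> {1..d} \<Longrightarrow> A i j = 0"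
      unfolding A quadratic_form_def using that by simp
    then obtain i j where "i \<in> {1..d}" "j \<in> {1..d}" "A i j \<noteq> 0"
      using f(3) U.J_closed(1) by blast
    then have "G_comp d 3 \<subseteq> J"
      using f(2) A by (intro J.degree_2_consequences) (auto simp: J.V_def)
    then show ?thesis using 2 by simp
  next
    case 3
    obtain A B where A: "f = of_yz (cubic_form d A B)"
      using G_comp_3_cubic_form f(1) 3 by metis
    have "cubic_form d A B \<notin> U.V" using f(3) A by (simp add: U.V_def)
    then obtain i j k where "i \<in> {1..d}" "j \<in> {1..d}" "k \<in> {1..d}"
      "A i j k + A j i k \<noteq> B i j k + B i k j \<or> A i j k + A j i k \<noteq> A i k j + A k i j"
      using U.symmetric_cubic_form_in_V by blast
    moreover have "cubic_form d A B \<in> J.V" using f(2) A by (simp add: J.V_def)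
    ultimately have "G_comp d 4 \<subseteq> J" using J.cubic_form_consequences by blast
    then show ?thesis using 3 by simp
  qed
qed

theorem theorem3p10:
  fixes d :: nat and \<alpha>1 \<alpha>2 :: "'k::field_char_0"
  assumes "d \<ge> 2" and "(\<alpha>1, \<alpha>2) \<noteq> (0, 0)" and "\<alpha>1 = \<alpha>2"
  shows "(\<forall>n\<in>{1, 2, 3}. \<forall>f\<in>GU_comp d \<alpha>1 \<alpha>2 n. f \<noteq> na_zero (GU_alg d \<alpha>1 \<alpha>2) \<longrightarrow>
            consequences d \<alpha>1 \<alpha>2 f (n + 1) = GU_comp d \<alpha>1 \<alpha>2 (n + 1)) \<and>
         (\<forall>m>4. consequences d \<alpha>1 \<alpha>2 (GU_proj d \<alpha>1 \<alpha>2 w31_2) m = {na_zero (GU_alg d \<alpha>1 \<alpha>2)})"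
proof -
  define \<alpha> where "\<alpha> = \<alpha>1"
  have \<alpha>: "\<alpha>1 = \<alpha>" "\<alpha>2 = \<alpha>" "\<alpha> \<noteq> 0" using assms by (auto simp: \<alpha>_def)
  define U where "U = U_ideal d \<alpha> \<alpha>"
  have UT: "U_T_ideal d \<alpha> U"
    unfolding U_def by (rule U_T_ideal_U_ideal) (use assms(1) \<alpha>(3) in auto)
  interpret U: U_T_ideal d \<alpha> U by fact
  interpret G_T_ideal d U by standard (rule U.T_ideal_J)
  have GU: "GU_alg d \<alpha> \<alpha> = Q" "GU_proj d \<alpha> \<alpha> = coset" "GU_comp d \<alpha> \<alpha> n = coset ` G_comp d n" for n
    by (simp_all add: GU_alg_def GU_proj_def GU_comp_def U_def)
  have low: "consequences d \<alpha> \<alpha> X (n + 1) = GU_comp d \<alpha> \<alpha> (n + 1)"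
    if n: "n \<in> {1, 2, 3}" and X: "X \<in> GU_comp d \<alpha> \<alpha> n" "X \<noteq> na_zero (GU_alg d \<alpha> \<alpha>)" for n X
  proof -
    from X obtain f where f: "f \<in> G_comp d n" "X = coset f" "coset f \<noteq> coset 0"
      unfolding GU Q_simps by blast
    then have "f \<notin> U" using coset_shift[of f 0] by auto
    \<comment> \<open>An element of the generated T-ideal has to lie in every T-ideal
      \<open>K\<close> containing \<open>X\<close>; the degree results are applied to the preimage
      of \<open>K\<close>.\<close>
    have "coset g \<in> K" if g: "g \<in> G_comp d (n + 1)" and K: "T_ideal Q K" "X \<in> K" for g K
    proof -
      let ?J = "{g \<in> G_carrier d. coset g \<in> K}"
      have "U_T_ideal d \<alpha> ?J"
        using T_ideal_preimage[OF K(1)] U.U_poly_in_J \<alpha>(3) by unfold_locales blast+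
      moreover have "f \<in> ?J" using f(1,2) K(2) by (simp add: G_comp_def)
      ultimately have "G_comp d (n + 1) \<subseteq> ?J"
        using consequences_of_degree_1_2_3 UT n f(1) \<open>f \<notin> U\<close> by blast
      then show ?thesis using g by blast
    qed
    then show ?thesis
      unfolding consequences_def T_ideal_generated_def GU by blast
  qed
  \<comment> \<open>Everything of degree above 4 vanishes in the quotient, so this holds for every
    \<open>X\<close>, in particular for the class of \<open>w31_2\<close>.\<close>
  have high: "consequences d \<alpha> \<alpha> X m = {na_zero (GU_alg d \<alpha> \<alpha>)}" if "m > 4" for X m
  proof -
    have "G_comp d m \<subseteq> U" using that by (intro U.G_comp_ge_5) simp
    then have "coset g = coset 0" if "g \<in> G_comp d m" for g
      using coset_shift[of g 0] that by auto
    \<comment> \<open>Zero has empty support and is homogeneous of every degree, so the component is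
      the zero space and not empty.\<close>
    moreover have "0 \<in> G_comp d m" by (simp add: G_comp_def)
    ultimately have "GU_comp d \<alpha> \<alpha> m = {na_zero Q}"
      unfolding GU Q_simps by blast
    moreover have "na_zero Q \<in> T_ideal_generated Q {X}"
      by (auto simp: T_ideal_generated_def T_ideal_def na_ideal_def)
    ultimately show ?thesis unfolding consequences_def GU by blast
  qed
  show ?thesis unfolding \<alpha>(1,2) by (intro conjI ballI allI impI low high)
qed

end
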